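(* Let $H$ be a finite-dimensional Hilbert space, regarded as a 1-cell $\mathbf{Hilb}\to\mathbf{Hilb}$ in $\mathbf{2Hilb}$, and let $n$ be a natural number. Nondegenerate measurements on $H$ with outcomes in $\mathbf{Hilb}^n$, that is, unitary 2-cells $\mu:H\Rightarrow W_L;W_R$ in $\mathbf{2Hilb}$, correspond bijectively to ordered orthonormal bases $(a_1,\ldots,a_n)$ of $H$, where $\mu$ corresponds to the basis $a_i=\mu^{-1}(e_i)$ with $(e_1,\ldots,e_n)$ the standard basis of $W_L;W_R=\mathbb{C}\oplus\cdots\oplus\mathbb{C}$ ($n$ summands).
   Context: $\mathbf{2Hilb}$ is the 2-category of finite-dimensional 2-Hilbert spaces in matrix form: objects are $\mathbf{Hilb}^n$, $n\in\mathbb{N}$; a 1-cell $\mathbf{Hilb}^n\to\mathbf{Hilb}^m$ is an $m\times n$ matrix of finite-dimensional Hilbert spaces, composed by matrix multiplication with $\oplus$ and $\otimes$; a 2-cell $F\Rightarrow G$ is a matrix of linear maps $F_{i,j}\to G_{i,j}$, composed vertically entrywise; $\dagger$ takes entrywise adjoints, and a 2-cell is unitary if it is inverse to its $\dagger$. $X;Y$ denotes "first $X$, then $Y$"; coherence isomorphisms are suppressed. The (canonical) witness of the object $\mathbf{Hilb}^n$ has 1-cells $W_L:\mathbf{Hilb}\to\mathbf{Hilb}^n$, the column matrix with $n$ entries $\mathbb{C}$, and $W_R:\mathbf{Hilb}^n\to\mathbf{Hilb}$, the row matrix with $n$ entries $\mathbb{C}$. A nondegenerate measurement on a system $T:I\to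 I$ ($I=\mathbf{Hilb}$ the monoidal unit) with outcomes in an object $A$ having witness $W_L:I\to A$, $W_R:A\to I$ is a unitary 2-cell $T\Rightarrow W_L;W_R$. *)

theory Defs
  imports Complex_Main "HOL-Library.FuncSet" "HOL-Library.Function_Algebras"
    "Jordan_Normal_Form.Matrix"
begin

section \<open>Finite-dimensional Hilbert spaces\<close>

text \<open>
  The entries of a 1-cell range over arbitrary finite-dimensional Hilbert spaces, so a Hilbert
  space is a value: a linear subspace \<open>hcarrier H\<close> of an ambient complex vector space (whose
  addition is that of the type and whose scalar multiplication is \<open>hscale H\<close>), with an inner
  product that is antilinear in the first argument.  An abstract space is the case
  \<open>hcarrier H = UNIV\<close>.  Completeness is automatic in finite dimension.
\<close>

record 'a hilb =
  hscale :: "complex \<Rightarrow> 'a \<Rightarrow> 'a"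
  hcarrier :: "'a set"
  hinner :: "'a \<Rightarrow> 'a \<Rightarrow> complex"

locale fd_hilbert = vector_space "hscale H" for H :: "'a::ab_group_add hilb" +
  assumes subspace_carrier: "subspace (hcarrier H)"
    and finite_dimensional: "\<exists>B. finite B \<and> span B = hcarrier H"
    and inner_add: "\<lbrakk>x \<in> hcarrier H; y \<in> hcarrier H; z \<in> hcarrier H\<rbrakk>
      \<Longrightarrow> hinner H x (y + z) = hinner H x y + hinner H x z"
    and inner_scale: "\<lbrakk>x \<in> hcarrier H; y \<in> hcarrier H\<rbrakk>
      \<Longrightarrow> hinner H x (hscale H c y) = c * hinner H x y"
    and inner_commute: "\<lbrakk>x \<in> hcarrier H; y \<in> hcarrier H\<rbrakk>
      \<Longrightarrow> hinner H y x = cnj (hinner H x y)"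
    and inner_pos: "\<lbrakk>x \<in> hcarrier H; x \<noteq> 0\<rbrakk> \<Longrightarrow> 0 < Re (hinner H x x)"

definition hilb_C :: "complex hilb" where
  "hilb_C = \<lparr>hscale = (*), hcarrier = UNIV, hinner = (\<lambda>z w. cnj z * w)\<rparr>"

text \<open>The linear maps between carriers, extensional so that equality is equality on the carrier.\<close>

definition hlinear :: "'a::ab_group_add hilb \<Rightarrow> 'b::ab_group_add hilb \<Rightarrow> ('a \<Rightarrow> 'b) set" where
  "hlinear H K = {f \<in> hcarrier H \<rightarrow>\<^sub>E hcarrier K.
     (\<forall>x\<in>hcarrier H. \<forall>y\<in>hcarrier H. f (x + y) = f x + f y) \<and>
     (\<forall>c. \<forall>x\<in>hcarrier H. f (hscale H c x) = hscale K c (f x))}"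

definition hadjoint ::
  "'a::ab_group_add hilb \<Rightarrow> 'b::ab_group_add hilb \<Rightarrow> ('a \<Rightarrow> 'b) \<Rightarrow> 'b \<Rightarrow> 'a" where
  "hadjoint H K f = (THE g. g \<in> hlinear K H \<and>
     (\<forall>x\<in>hcarrier H. \<forall>y\<in>hcarrier K. hinner K (f x) y = hinner H x (g y)))"

definition ordered_onb :: "'a::ab_group_add hilb \<Rightarrow> 'a list \<Rightarrow> bool" where
  "ordered_onb H as \<longleftrightarrow>
     set as \<subseteq> hcarrier H \<and>
     (\<forall>i<length as. \<forall>j<length as. hinner H (as ! i) (as ! j) = (if i = j then 1 else 0)) \<and>
     module.span (hscale H) (set as) = hcarrier H"

text \<open>
  Elements of the sum of \<open>K 0, \<dots>, K (n - 1)\<close> are families vanishing from index \<open>n\<close> on; for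
  \<open>j \<ge> n\<close> the value \<open>K j\<close> only contributes the scalar multiplication of the ambient space.
\<close>

definition dsum :: "nat \<Rightarrow> (nat \<Rightarrow> 'a::ab_group_add hilb) \<Rightarrow> (nat \<Rightarrow> 'a) hilb" where
  "dsum n K =
    \<lparr>hscale = (\<lambda>c f j. hscale (K j) c (f j)),
     hcarrier = {f. (\<forall>j<n. f j \<in> hcarrier (K j)) \<and> (\<forall>j\<ge>n. f j = 0)},
     hinner = (\<lambda>f g. \<Sum>j<n. hinner (K j) (f j) (g j))\<rparr>"

definition dsum_incl :: "nat \<Rightarrow> 'a::ab_group_add \<Rightarrow> nat \<Rightarrow> 'a" where
  "dsum_incl i x = (\<lambda>j. if j = i then x else 0)"

text \<open>
  The tensor product is realised inside the space of functions that are antilinear in each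
  argument: \<open>x \<otimes> y\<close> is the function taking \<open>(h, k)\<close> to \<open>\<langle>h, x\<rangle> \<langle>k, y\<rangle>\<close>.  This embeds the
  algebraic tensor product because the inner products are nondegenerate.
\<close>

definition pure_tensor :: "'a hilb \<Rightarrow> 'b hilb \<Rightarrow> 'a \<Rightarrow> 'b \<Rightarrow> 'a \<Rightarrow> 'b \<Rightarrow> complex" where
  "pure_tensor H K x y = (\<lambda>h k.
     if h \<in> hcarrier H \<and> k \<in> hcarrier K then hinner H h x * hinner K k y else 0)"

text \<open>
  The inner product is the sesquilinear extension of
  \<open>\<langle>x' \<otimes> y', x \<otimes> y\<rangle> = \<langle>x', x\<rangle> \<langle>y', y\<rangle>\<close>; in terms of the realisation above,
  \<open>\<langle>f, x \<otimes> y\<rangle> = cnj (f x y)\<close>.  Independence of the decomposition of the second argument is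
  lemma \<open>tensor_inner_eq\<close>.
\<close>

definition tensor_inner ::
  "'a hilb \<Rightarrow> 'b hilb \<Rightarrow> ('a \<Rightarrow> 'b \<Rightarrow> complex) \<Rightarrow> ('a \<Rightarrow> 'b \<Rightarrow> complex) \<Rightarrow> complex" where
  "tensor_inner H K f g = (THE v. \<exists>ps. set ps \<subseteq> hcarrier H \<times> hcarrier K \<and>
     g = (\<Sum>(x, y)\<leftarrow>ps. pure_tensor H K x y) \<and> v = (\<Sum>(x, y)\<leftarrow>ps. cnj (f x y)))"

definition fscale :: "complex \<Rightarrow> ('a \<Rightarrow> 'b \<Rightarrow> complex) \<Rightarrow> 'a \<Rightarrow> 'b \<Rightarrow> complex" where
  "fscale c f = (\<lambda>x y. c * f x y)"

definition tensor :: "'a hilb \<Rightarrow> 'b hilb \<Rightarrow> ('a \<Rightarrow> 'b \<Rightarrow> complex) hilb" where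
  "tensor H K =
    \<lparr>hscale = fscale,
     hcarrier = module.span fscale
       {pure_tensor H K x y | x y. x \<in> hcarrier H \<and> y \<in> hcarrier K},
     hinner = tensor_inner H K\<rparr>"


section \<open>The 2-category 2Hilb in matrix form\<close>

text \<open>
  The object \<open>Hilb\<^sup>n\<close> is represented by the natural number \<open>n\<close>, so \<open>I = Hilb\<close> is 1.
  The element type of the entries of a composite 1-cell differs from those of the factors, so
  1-cells with entries on different types are related by polymorphism.
\<close>

definition one_cells :: "nat \<Rightarrow> nat \<Rightarrow> 'a::ab_group_add hilb mat set" where
  "one_cells n m = {F \<in> carrier_mat m n. \<forall>i<m. \<forall>j<n. fd_hilbert (F $$ (i, j))}"

definition one_comp :: "'a::ab_group_add hilb mat \<Rightarrow> 'b::ab_group_add hilb mat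
    \<Rightarrow> (nat \<Rightarrow> 'b \<Rightarrow> 'a \<Rightarrow> complex) hilb mat" (infixl ";;" 70) where
  "X ;; Y = mat (dim_row Y) (dim_col X)
     (\<lambda>(i, k). dsum (dim_row X) (\<lambda>j. tensor (Y $$ (i, j)) (X $$ (j, k))))"

definition two_cells :: "'a::ab_group_add hilb mat \<Rightarrow> 'b::ab_group_add hilb mat
    \<Rightarrow> ('a \<Rightarrow> 'b) mat set" where
  "two_cells F G = {\<alpha> \<in> carrier_mat (dim_row F) (dim_col F).
     dim_row G = dim_row F \<and> dim_col G = dim_col F \<and>
     (\<forall>i<dim_row F. \<forall>j<dim_col F. \<alpha> $$ (i, j) \<in> hlinear (F $$ (i, j)) (G $$ (i, j)))}"

definition id_cell :: "'a hilb mat \<Rightarrow> ('a \<Rightarrow> 'a) mat" where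
  "id_cell F = mat (dim_row F) (dim_col F) (\<lambda>ij. \<lambda>x\<in>hcarrier (F $$ ij). x)"

text \<open>\<open>vcomp F \<beta> \<alpha>\<close> is \<open>\<alpha>\<close> followed by \<open>\<beta>\<close>, where \<open>F\<close> is the domain of \<open>\<alpha>\<close>.\<close>

definition vcomp ::
  "'a hilb mat \<Rightarrow> ('b \<Rightarrow> 'c) mat \<Rightarrow> ('a \<Rightarrow> 'b) mat \<Rightarrow> ('a \<Rightarrow> 'c) mat" where
  "vcomp F \<beta> \<alpha> = mat (dim_row F) (dim_col F)
     (\<lambda>ij. compose (hcarrier (F $$ ij)) (\<beta> $$ ij) (\<alpha> $$ ij))"

definition dagger :: "'a::ab_group_add hilb mat \<Rightarrow> 'b::ab_group_add hilb mat
    \<Rightarrow> ('a \<Rightarrow> 'b) mat \<Rightarrow> ('b \<Rightarrow> 'a) mat" where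
  "dagger F G \<alpha> = mat (dim_row F) (dim_col F)
     (\<lambda>ij. hadjoint (F $$ ij) (G $$ ij) (\<alpha> $$ ij))"

definition unitary_cell :: "'a::ab_group_add hilb mat \<Rightarrow> 'b::ab_group_add hilb mat
    \<Rightarrow> ('a \<Rightarrow> 'b) mat \<Rightarrow> bool" where
  "unitary_cell F G \<mu> \<longleftrightarrow> \<mu> \<in> two_cells F G \<and>
     vcomp F (dagger F G \<mu>) \<mu> = id_cell F \<and> vcomp G \<mu> (dagger F G \<mu>) = id_cell G"

text \<open>On unitary 2-cells this is the two-sided inverse, see lemma \<open>inverse_cell_unitary\<close>.\<close>

definition inverse_cell ::
  "'a hilb mat \<Rightarrow> 'b hilb mat \<Rightarrow> ('a \<Rightarrow> 'b) mat \<Rightarrow> ('b \<Rightarrow> 'a) mat" where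
  "inverse_cell F G \<mu> = mat (dim_row F) (dim_col F)
     (\<lambda>ij. \<lambda>y\<in>hcarrier (G $$ ij). inv_into (hcarrier (F $$ ij)) (\<mu> $$ ij) y)"

definition W\<^sub>L :: "nat \<Rightarrow> complex hilb mat" where
  "W\<^sub>L n = mat n 1 (\<lambda>_. hilb_C)"

definition W\<^sub>R :: "nat \<Rightarrow> complex hilb mat" where
  "W\<^sub>R n = mat 1 n (\<lambda>_. hilb_C)"

text \<open>\<open>H\<close> regarded as a 1-cell from \<open>Hilb\<close> to \<open>Hilb\<close>.\<close>

definition system :: "'a hilb \<Rightarrow> 'a hilb mat" where
  "system H = mat 1 1 (\<lambda>_. H)"

definition nondegenerate_measurement :: "nat \<Rightarrow> 'a::ab_group_add hilb mat
    \<Rightarrow> ('a \<Rightarrow> nat \<Rightarrow> complex \<Rightarrow> complex \<Rightarrow> complex) mat \<Rightarrow> bool" where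
  "nondegenerate_measurement n T \<mu> \<longleftrightarrow> unitary_cell T (W\<^sub>L n ;; W\<^sub>R n) \<mu>"

text \<open>
  The only entry of \<open>W\<^sub>L n ;; W\<^sub>R n\<close> is literally a sum of \<open>n\<close> copies of \<open>\<complex> \<otimes> \<complex>\<close>.  Under the
  coherence isomorphism \<open>\<complex> \<otimes> \<complex> \<cong> \<complex>\<close>, \<open>z \<otimes> w \<mapsto> z w\<close>, which is suppressed informally, the
  standard basis vector of index \<open>i\<close> is \<open>1 \<otimes> 1\<close> in the summand \<open>i\<close>; see the lemmas
  \<open>witness_coherence\<close> and \<open>witness_coherence_std\<close>.
\<close>

definition witness_std :: "nat \<Rightarrow> nat \<Rightarrow> complex \<Rightarrow> complex \<Rightarrow> complex" where
  "witness_std i = dsum_incl i (pure_tensor hilb_C hilb_C 1 1)"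

definition measurement_basis :: "nat \<Rightarrow> 'a hilb
    \<Rightarrow> ('a \<Rightarrow> nat \<Rightarrow> complex \<Rightarrow> complex \<Rightarrow> complex) mat \<Rightarrow> 'a list" where
  "measurement_basis n H \<mu> =
     map (\<lambda>i. (inverse_cell (system H) (W\<^sub>L n ;; W\<^sub>R n) \<mu> $$ (0, 0)) (witness_std i)) [0..<n]"


section \<open>The constructions are well defined\<close>

context fd_hilbert
begin

lemma carrier_0: "0 \<in> hcarrier H"
  using subspace_carrier by (rule subspace_0)

lemma carrier_add: "x \<in> hcarrier H \<Longrightarrow> y \<in> hcarrier H \<Longrightarrow> x + y \<in> hcarrier H"
  using subspace_carrier by (rule subspace_add)

lemma carrier_diff: "x \<in> hcarrier H \<Longrightarrow> y \<in> hcarrier H \<Longrightarrow> x - y \<in> hcarrier H"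
  using subspace_carrier by (rule subspace_diff)

lemma carrier_scale: "x \<in> hcarrier H \<Longrightarrow> hscale H c x \<in> hcarrier H"
  using subspace_carrier by (rule subspace_scale)

lemma carrier_sum: "(\<And>i. i \<in> I \<Longrightarrow> f i \<in> hcarrier H) \<Longrightarrow> sum f I \<in> hcarrier H"
  using subspace_carrier by (rule subspace_sum)

lemma inner_0_right: "x \<in> hcarrier H \<Longrightarrow> hinner H x 0 = 0"
  using inner_add[of x 0 0] carrier_0 by simp

lemma inner_0_left: "x \<in> hcarrier H \<Longrightarrow> hinner H 0 x = 0"
  using inner_commute[of x 0] carrier_0 by (simp add: inner_0_right)

lemma inner_add_left: "\<lbrakk>x \<in> hcarrier H; y \<in> hcarrier H; z \<in> hcarrier H\<rbrakk>
  \<Longrightarrow> hinner H (x + y) z = hinner H x z + hinner H y z"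
  using inner_commute[of z "x + y"] inner_commute[of z x] inner_commute[of z y]
  by (simp add: inner_add carrier_add)

lemma inner_scale_left: "\<lbrakk>x \<in> hcarrier H; y \<in> hcarrier H\<rbrakk>
  \<Longrightarrow> hinner H (hscale H c x) y = cnj c * hinner H x y"
  using inner_commute[of y "hscale H c x"] inner_commute[of y x]
  by (simp add: inner_scale carrier_scale)

lemma inner_diff: "\<lbrakk>x \<in> hcarrier H; y \<in> hcarrier H; z \<in> hcarrier H\<rbrakk>
  \<Longrightarrow> hinner H x (y - z) = hinner H x y - hinner H x z"
  using inner_add[of x "y - z" z] by (simp add: carrier_diff)

lemma inner_sum: "x \<in> hcarrier H \<Longrightarrow> (\<And>i. i \<in> I \<Longrightarrow> f i \<in> hcarrier H)
  \<Longrightarrow> hinner H x (sum f I) = (\<Sum>i\<in>I. hinner H x (f i))"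
  by (induction I rule: infinite_finite_induct)
     (auto simp: inner_0_right inner_add carrier_sum)

lemma inner_self_eq_0: "x \<in> hcarrier H \<Longrightarrow> hinner H x x = 0 \<Longrightarrow> x = 0"
  using inner_pos[of x] by force

lemma inner_self_real: "x \<in> hcarrier H \<Longrightarrow> hinner H x x = complex_of_real (Re (hinner H x x))"
  using inner_commute[of x x] by (auto simp: complex_eq_iff)

lemma orthogonal_span:
  assumes "S \<subseteq> hcarrier H" "d \<in> hcarrier H" "\<And>s. s \<in> S \<Longrightarrow> hinner H d s = 0" "x \<in> span S"
  shows "hinner H d x = 0"
proof -
  have "x \<in> hcarrier H \<and> hinner H d x = 0" using assms(4)
  proof (induction rule: span_induct_alt)
    case base
    then show ?case using assms(2) by (simp add: carrier_0 inner_0_right)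
  next
    case (step c x y)
    then show ?case using assms
      by (auto simp: carrier_add carrier_scale inner_add inner_scale subset_iff)
  qed
  then show ?thesis ..
qed

lemma gram_schmidt:
  assumes "finite B" "B \<subseteq> hcarrier H"
  shows "\<exists>as. set as \<subseteq> hcarrier H \<and> span (set as) = span B \<and>
    (\<forall>i<length as. \<forall>j<length as. hinner H (as ! i) (as ! j) = (if i = j then 1 else 0))"
  using assms
proof (induction B rule: finite_induct)
  case empty
  show ?case by (rule exI[of _ "[]"]) simp
next
  case (insert b B)
  then obtain as where as: "set as \<subseteq> hcarrier H" "span (set as) = span B"
    and on: "\<And>i j. i < length as \<Longrightarrow> j < length as \<Longrightarrow>
      hinner H (as ! i) (as ! j) = (if i = j then 1 else 0)" by auto
  have b: "b \<in> hcarrier H" using insert by auto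
  have asi: "as ! i \<in> hcarrier H" if "i < length as" for i using as that by auto
  define p where "p = (\<Sum>k<length as. hscale H (hinner H (as ! k) b) (as ! k))"
  define r where "r = b - p"
  have p: "p \<in> hcarrier H" unfolding p_def by (intro carrier_sum carrier_scale asi) auto
  have pspan: "p \<in> span B" unfolding p_def as(2)[symmetric]
    by (intro span_sum span_scale span_base) auto
  have r: "r \<in> hcarrier H" using b p by (simp add: r_def carrier_diff)
  have orth: "hinner H (as ! i) r = 0" if i: "i < length as" for i
  proof -
    have "hinner H (as ! i) p = (\<Sum>k<length as. hinner H (as ! k) b * (if i = k then 1 else 0))"
      unfolding p_def using i by (subst inner_sum) (auto simp: asi carrier_scale inner_scale on)
    also have "\<dots> = hinner H (as ! i) b"
      using i by (simp add: if_distrib[of "(*) _"] cong: if_cong)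
    finally show ?thesis using i by (simp add: r_def inner_diff asi b p)
  qed
  show ?case
  proof (cases "r = 0")
    case True
    then have "b \<in> span B" using pspan by (simp add: r_def)
    then have "span (insert b B) = span B" by (rule span_redundant)
    then show ?thesis using as on by auto
  next
    case False
    define t where "t = Re (hinner H r r)"
    have t: "t > 0" "hinner H r r = complex_of_real t"
      using inner_pos[OF r False] inner_self_real[OF r] by (auto simp: t_def)
    define s where "s = complex_of_real (1 / sqrt t)"
    define u where "u = hscale H s r"
    have s0: "s \<noteq> 0" using t by (simp add: s_def)
    have u: "u \<in> hcarrier H" using r by (simp add: u_def carrier_scale)
    have uu: "hinner H u u = 1"
    proof -
      have "hinner H u u = complex_of_real (1 / sqrt t * (1 / sqrt t) * t)"
        using r t by (simp add: u_def inner_scale inner_scale_left carrier_scale s_def flip: of_real_mult)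
      also have "1 / sqrt t * (1 / sqrt t) * t = 1" using t by (simp add: field_simps)
      finally show ?thesis by simp
    qed
    have au: "hinner H (as ! i) u = 0" "hinner H u (as ! i) = 0" if "i < length as" for i
      using orth[OF that] inner_commute[of "as ! i" u] asi[OF that] r u
      by (auto simp: u_def inner_scale)
    have span_eq: "span (set (as @ [u])) = span (insert b B)"
    proof -
      have su: "span (set (as @ [u])) = span (insert u B)"
        using as(2) by (simp add: span_insert)
      have b_eq: "b = hscale H (inverse s) u + p"
        using s0 by (simp add: u_def r_def)
      have "span (insert u B) = span (insert b B)"
      proof (rule span_eq[THEN iffD2], intro conjI subsetI)
        fix x assume "x \<in> insert u B"
        then show "x \<in> span (insert b B)"
        proof
          assume "x = u"
          moreover have "p \<in> span (insert b B)" using pspan span_mono[of B "insert b B"] by auto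
          ultimately show ?thesis unfolding u_def r_def
            by (auto intro!: span_scale span_diff intro: span_base)
        qed (auto intro: span_base)
      next
        fix x assume "x \<in> insert b B"
        then show "x \<in> span (insert u B)"
        proof
          assume "x = b"
          moreover have "p \<in> span (insert u B)" using pspan span_mono[of B "insert u B"] by auto
          ultimately show ?thesis
            by (subst \<open>x = b\<close>, subst b_eq) (auto intro!: span_add span_scale intro: span_base)
        qed (auto intro: span_base)
      qed
      then show ?thesis using su by simp
    qed
    have "hinner H ((as @ [u]) ! i) ((as @ [u]) ! j) = (if i = j then 1 else 0)"
      if "i < length (as @ [u])" "j < length (as @ [u])" for i j
      using that by (auto simp: nth_append on au uu less_Suc_eq)
    then show ?thesis using as u span_eq by (intro exI[of _ "as @ [u]"]) auto
  qed
qed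

lemma ordered_onb_exists: "\<exists>as. ordered_onb H as"
proof -
  obtain B where B: "finite B" "span B = hcarrier H" using finite_dimensional by auto
  have "B \<subseteq> hcarrier H" using B(2) span_superset by blast
  with gram_schmidt[OF B(1)] B(2) show ?thesis unfolding ordered_onb_def by metis
qed

lemma onb_expansion:
  assumes "ordered_onb H as" "x \<in> hcarrier H"
  shows "x = (\<Sum>k<length as. hscale H (hinner H (as ! k) x) (as ! k))"
proof -
  let ?p = "\<Sum>k<length as. hscale H (hinner H (as ! k) x) (as ! k)"
  have as: "as ! k \<in> hcarrier H" if "k < length as" for k
    using assms that by (auto simp: ordered_onb_def)
  have p: "?p \<in> hcarrier H" by (intro carrier_sum carrier_scale as) auto
  have d: "x - ?p \<in> hcarrier H" using assms p by (simp add: carrier_diff)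
  have "hinner H (as ! i) (x - ?p) = 0" if i: "i < length as" for i
  proof -
    have "hinner H (as ! i) ?p = (\<Sum>k<length as. hinner H (as ! k) x * (if i = k then 1 else 0))"
      using i assms(1)
      by (subst inner_sum) (auto simp: as carrier_scale inner_scale ordered_onb_def)
    also have "\<dots> = hinner H (as ! i) x"
      using i by (simp add: if_distrib[of "(*) _"] cong: if_cong)
    finally show ?thesis using i p assms(2) by (simp add: inner_diff as)
  qed
  then have "hinner H (x - ?p) (as ! i) = 0" if i: "i < length as" for i
    using inner_commute[of "as ! i" "x - ?p"] as d i by auto
  then have "hinner H (x - ?p) s = 0" if "s \<in> set as" for s
    using that by (auto simp: in_set_conv_nth)
  moreover have "x - ?p \<in> span (set as)" "set as \<subseteq> hcarrier H"
    using d assms by (auto simp: ordered_onb_def)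
  ultimately have "hinner H (x - ?p) (x - ?p) = 0" using orthogonal_span d by blast
  then have "x - ?p = 0" using inner_self_eq_0 d by blast
  then show ?thesis by simp
qed

end

lemma fd_hilbert_C: "fd_hilbert hilb_C"
proof -
  interpret vector_space "(*) :: complex \<Rightarrow> complex \<Rightarrow> complex"
    by unfold_locales (auto simp: algebra_simps)
  have "span {1::complex} = UNIV"
  proof (intro equalityI subsetI)
    fix x :: complex
    have "x * 1 \<in> span {1}" by (intro span_scale span_base) simp
    then show "x \<in> span {1}" by simp
  qed simp
  then have fin: "\<exists>B. finite B \<and> span B = (UNIV :: complex set)" by blast
  have pos: "0 < Re (cnj x * x)" if "x \<noteq> 0" for x :: complex
    using complex_neq_0[of x] that by (simp add: power2_eq_square)
  show ?thesis
  proof (rule fd_hilbert.intro)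
    show "vector_space (hscale hilb_C)"
      by (simp add: hilb_C_def vector_space_axioms)
    show "fd_hilbert_axioms hilb_C"
      unfolding hilb_C_def fd_hilbert_axioms_def hilb.simps
      by (intro conjI allI impI subspace_UNIV fin pos) (simp_all add: distrib_left)
  qed
qed

lemma sum_fun_apply: "(\<Sum>i\<in>I. f i) x = (\<Sum>i\<in>I. f i x)"
  by (induction I rule: infinite_finite_induct) auto

lemma sum_list_fun_apply: "(\<Sum>i\<leftarrow>xs. f i) x = (\<Sum>i\<leftarrow>xs. f i x)"
  by (induction xs) auto

lemma fd_hilbert_dsum:
  assumes K: "\<And>j. j < n \<Longrightarrow> fd_hilbert (K j)" and "\<And>j. vector_space (hscale (K j))"
  shows "fd_hilbert (dsum n K)"
proof -
  let ?D = "hcarrier (dsum n K)"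
  interpret vector_space "hscale (dsum n K)"
  proof -
    interpret K: vector_space "hscale (K j)" for j by fact
    show "vector_space (hscale (dsum n K))"
      unfolding dsum_def hilb.simps
      by unfold_locales
        (auto simp: fun_eq_iff K.scale_right_distrib K.scale_left_distrib)
  qed
  have sc: "hscale (K j) c 0 = 0" for j c
  proof -
    interpret K: vector_space "hscale (K j)" by fact
    show ?thesis by simp
  qed
  have D: "f \<in> ?D \<longleftrightarrow> (\<forall>j<n. f j \<in> hcarrier (K j)) \<and> (\<forall>j\<ge>n. f j = 0)" for f
    by (simp add: dsum_def)
  have sub: "subspace ?D"
    by (rule subspaceI)
       (auto simp: D dsum_def sc intro: fd_hilbert.carrier_0[OF K]
          fd_hilbert.carrier_add[OF K] fd_hilbert.carrier_scale[OF K])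
  have "\<forall>j. \<exists>B. j < n \<longrightarrow> finite B \<and> module.span (hscale (K j)) B = hcarrier (K j)"
    using fd_hilbert.finite_dimensional[OF K] by blast
  then obtain B where B: "\<And>j. j < n \<Longrightarrow> finite (B j)"
      "\<And>j. j < n \<Longrightarrow> module.span (hscale (K j)) (B j) = hcarrier (K j)" by metis
  define E where "E = (\<Union>j<n. dsum_incl j ` B j)"
  have incl_span: "dsum_incl j x \<in> span E" if j: "j < n" and x: "x \<in> hcarrier (K j)" for j x
  proof -
    interpret K: vector_space "hscale (K j)" by fact
    have "x \<in> K.span (B j)" using B(2)[OF j] x by simp
    then show ?thesis
    proof (induction rule: K.span_induct_alt)
      case base
      have "dsum_incl j 0 = (0 :: nat \<Rightarrow> 'a)" by (simp add: dsum_incl_def fun_eq_iff)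
      then show ?case using span_zero[of E] by metis
    next
      case (step c x y)
      have "dsum_incl j (hscale (K j) c x + y)
          = hscale (dsum n K) c (dsum_incl j x) + dsum_incl j y"
        by (simp add: dsum_incl_def dsum_def fun_eq_iff sc)
      moreover have "dsum_incl j x \<in> span E"
        using step j by (intro span_base) (auto simp: E_def)
      ultimately show ?case using step span_add span_scale by metis
    qed
  qed
  have "span E = ?D"
  proof
    have "E \<subseteq> ?D"
    proof
      fix e assume "e \<in> E"
      then obtain j x where j: "j < n" "x \<in> B j" and e: "e = dsum_incl j x"
        by (auto simp: E_def)
      interpret K: vector_space "hscale (K j)" by fact
      have "x \<in> hcarrier (K j)" using j B(2)[of j] K.span_base by blast
      then show "e \<in> ?D" using j e by (auto simp: D dsum_incl_def fd_hilbert.carrier_0[OF K])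
    qed
    then show "span E \<subseteq> ?D" using sub by (rule span_minimal)
    show "?D \<subseteq> span E"
    proof
      fix f assume f: "f \<in> ?D"
      have "f = (\<Sum>j<n. dsum_incl j (f j))"
      proof
        fix i
        show "f i = (\<Sum>j<n. dsum_incl j (f j)) i"
          using f by (cases "i < n") (auto simp: sum_fun_apply dsum_incl_def D)
      qed
      also have "\<dots> \<in> span E" using f by (intro span_sum incl_span) (auto simp: D)
      finally show "f \<in> span E" .
    qed
  qed
  moreover have "finite E" using B(1) by (auto simp: E_def)
  ultimately have fin: "\<exists>E. finite E \<and> span E = ?D" by blast
  have pos: "0 < Re (hinner (dsum n K) f f)" if f: "f \<in> ?D" "f \<noteq> 0" for f
  proof -
    obtain i where i: "f i \<noteq> 0" using f(2) by (auto simp: fun_eq_iff)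
    then have "i < n" using f(1) by (metis D not_le)
    have nonneg: "0 \<le> Re (hinner (K j) (f j) (f j))" if "j < n" for j
      using f(1) that fd_hilbert.inner_pos[OF K[OF that], of "f j"]
        fd_hilbert.inner_0_right[OF K[OF that], of "f j"]
      by (cases "f j = 0") (auto simp: D)
    have "0 < (\<Sum>j<n. Re (hinner (K j) (f j) (f j)))"
    proof (rule sum_pos2)
      show "0 < Re (hinner (K i) (f i) (f i))"
        using i \<open>i < n\<close> f(1) by (auto simp: D intro: fd_hilbert.inner_pos[OF K])
    qed (use \<open>i < n\<close> nonneg in auto)
    then show ?thesis by (simp add: dsum_def)
  qed
  show ?thesis
  proof (rule fd_hilbert.intro)
    show "vector_space (hscale (dsum n K))" ..
    show "fd_hilbert_axioms (dsum n K)"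
    proof
      show "subspace ?D" by (rule sub)
      show "\<exists>B. finite B \<and> span B = ?D" by (rule fin)
      show "0 < Re (hinner (dsum n K) x x)" if "x \<in> ?D" "x \<noteq> 0" for x
        using that by (rule pos)
    next
      fix x y z c
      assume x: "x \<in> ?D" and y: "y \<in> ?D"
      show "hinner (dsum n K) x (hscale (dsum n K) c y) = c * hinner (dsum n K) x y"
        using x y by (auto simp: dsum_def sum_distrib_left fd_hilbert.inner_scale[OF K]
            intro!: sum.cong)
      show "hinner (dsum n K) y x = cnj (hinner (dsum n K) x y)"
        using x y by (auto simp: dsum_def intro!: sum.cong fd_hilbert.inner_commute[OF K])
      assume z: "z \<in> ?D"
      show "hinner (dsum n K) x (y + z) = hinner (dsum n K) x y + hinner (dsum n K) x z"
        using x y z by (auto simp: dsum_def fd_hilbert.inner_add[OF K]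
            simp flip: sum.distrib intro!: sum.cong)
    qed
  qed
qed

lemma vector_space_fscale: "vector_space fscale"
  by unfold_locales (auto simp: fscale_def fun_eq_iff algebra_simps)

locale tensor_pair = H: fd_hilbert H + K: fd_hilbert K
  for H :: "'a::ab_group_add hilb" and K :: "'b::ab_group_add hilb"
begin

sublocale F: vector_space "fscale :: complex \<Rightarrow> ('a \<Rightarrow> 'b \<Rightarrow> complex) \<Rightarrow> _"
  by (rule vector_space_fscale)

abbreviation "pure \<equiv> pure_tensor H K"
abbreviation "T \<equiv> hcarrier (tensor H K)"
abbreviation "pairs \<equiv> hcarrier H \<times> hcarrier K"

lemma T_def': "T = F.span {pure x y | x y. x \<in> hcarrier H \<and> y \<in> hcarrier K}"
  by (simp add: tensor_def)

lemma pure_in_T: "x \<in> hcarrier H \<Longrightarrow> y \<in> hcarrier K \<Longrightarrow> pure x y \<in> T"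
  unfolding T_def' by (rule F.span_base) blast

lemma subspace_T: "F.subspace T"
  unfolding T_def' by (rule F.subspace_span)

lemma sum_pure_in_T: "set ps \<subseteq> pairs \<Longrightarrow> (\<Sum>(x, y)\<leftarrow>ps. pure x y) \<in> T"
  by (induction ps) (auto intro: F.subspace_0 F.subspace_add subspace_T pure_in_T)

lemma T_decomposition:
  assumes "f \<in> T"
  obtains ps where "set ps \<subseteq> pairs" "f = (\<Sum>(x, y)\<leftarrow>ps. pure x y)"
proof -
  have "\<exists>ps. set ps \<subseteq> pairs \<and> f = (\<Sum>(x, y)\<leftarrow>ps. pure x y)"
    using assms unfolding T_def'
  proof (induction rule: F.span_induct_alt)
    case base
    show ?case by (rule exI[of _ "[]"]) simp
  next
    case (step c g f)
    then obtain ps x y where ps: "set ps \<subseteq> pairs" "f = (\<Sum>(x, y)\<leftarrow>ps. pure x y)"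
      and g: "g = pure x y" "x \<in> hcarrier H" "y \<in> hcarrier K" by blast
    have "fscale c g = pure (hscale H c x) y"
      using g by (auto simp: fun_eq_iff fscale_def pure_tensor_def H.inner_scale)
    then show ?case using ps g
      by (intro exI[of _ "(hscale H c x, y) # ps"]) (auto simp: H.carrier_scale)
  qed
  then show ?thesis using that by blast
qed

lemma T_apply: "(\<Sum>(x, y)\<leftarrow>ps. pure x y) h k = (\<Sum>(x, y)\<leftarrow>ps. pure x y h k)"
  by (induction ps) auto

lemma inner_swap:
  assumes "set ps \<subseteq> pairs" "set qs \<subseteq> pairs"
  shows "(\<Sum>(x, y)\<leftarrow>ps. cnj ((\<Sum>(a, b)\<leftarrow>qs. pure a b) x y))
    = (\<Sum>(a, b)\<leftarrow>qs. (\<Sum>(x, y)\<leftarrow>ps. pure x y) a b)"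
  using assms(1)
proof (induction ps)
  case Nil
  show ?case by (induction qs) auto
next
  case (Cons p ps)
  obtain x y where p: "p = (x, y)" by force
  have xy: "x \<in> hcarrier H" "y \<in> hcarrier K" using Cons p by auto
  have "cnj ((\<Sum>(a, b)\<leftarrow>qs. pure a b) x y) = (\<Sum>(a, b)\<leftarrow>qs. pure x y a b)"
    using assms(2)
  proof (induction qs)
    case (Cons q qs)
    then show ?case using xy H.inner_commute[of x "fst q"] K.inner_commute[of y "snd q"]
      by (auto simp: pure_tensor_def split: prod.splits)
  qed simp
  then have "(\<Sum>(x, y)\<leftarrow>p # ps. cnj ((\<Sum>(a, b)\<leftarrow>qs. pure a b) x y))
    = (\<Sum>(a, b)\<leftarrow>qs. pure x y a b) + (\<Sum>(a, b)\<leftarrow>qs. (\<Sum>(x, y)\<leftarrow>ps. pure x y) a b)"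
    using Cons p by simp
  also have "\<dots> = (\<Sum>(a, b)\<leftarrow>qs. (\<Sum>(x, y)\<leftarrow>p # ps. pure x y) a b)"
    unfolding p by (simp add: case_prod_unfold sum_list_addf)
  finally show ?case .
qed

lemma tensor_inner_eq:
  assumes "f \<in> T" "set ps \<subseteq> pairs" "g = (\<Sum>(x, y)\<leftarrow>ps. pure x y)"
  shows "tensor_inner H K f g = (\<Sum>(x, y)\<leftarrow>ps. cnj (f x y))"
proof -
  obtain qs where qs: "set qs \<subseteq> pairs" "f = (\<Sum>(x, y)\<leftarrow>qs. pure x y)"
    using T_decomposition assms(1) by blast
  show ?thesis unfolding tensor_inner_def
  proof (rule the_equality)
    fix v assume "\<exists>ps. set ps \<subseteq> pairs \<and>
       g = (\<Sum>(x, y)\<leftarrow>ps. pure x y) \<and> v = (\<Sum>(x, y)\<leftarrow>ps. cnj (f x y))"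
    then obtain ps' where ps': "set ps' \<subseteq> pairs" "g = (\<Sum>(x, y)\<leftarrow>ps'. pure x y)"
      "v = (\<Sum>(x, y)\<leftarrow>ps'. cnj (f x y))" by blast
    show "v = (\<Sum>(x, y)\<leftarrow>ps. cnj (f x y))"
      using inner_swap[OF ps'(1) qs(1)] inner_swap[OF assms(2) qs(1)] ps' assms(3) qs(2)
      by metis
  qed (use assms in blast)
qed

lemma tensor_inner_eq':
  assumes "g \<in> T" "set qs \<subseteq> pairs" "f = (\<Sum>(x, y)\<leftarrow>qs. pure x y)"
  shows "tensor_inner H K f g = (\<Sum>(x, y)\<leftarrow>qs. g x y)"
proof -
  obtain ps where ps: "set ps \<subseteq> pairs" "g = (\<Sum>(x, y)\<leftarrow>ps. pure x y)"
    using T_decomposition assms(1) by blast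
  have "f \<in> T" using sum_pure_in_T assms by blast
  then show ?thesis using tensor_inner_eq[OF _ ps] inner_swap[OF ps(1) assms(2)] ps assms by metis
qed

lemma tensor_inner_pure:
  assumes "x' \<in> hcarrier H" "y' \<in> hcarrier K" "x \<in> hcarrier H" "y \<in> hcarrier K"
  shows "hinner (tensor H K) (pure x' y') (pure x y) = hinner H x' x * hinner K y' y"
proof -
  have "tensor_inner H K (pure x' y') (pure x y) = pure x y x' y'"
    using tensor_inner_eq'[of "pure x y" "[(x', y')]"] assms by (simp add: pure_in_T)
  then show ?thesis using assms by (simp add: tensor_def pure_tensor_def)
qed

lemma T_antilinear:
  assumes "f \<in> T" "h \<in> hcarrier H" "k \<in> hcarrier K"
  shows "f (hscale H c h) k = cnj c * f h k"
  using assms(1) unfolding T_def'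
proof (induction rule: F.span_induct_alt)
  case (step d g f)
  then show ?case using assms
    by (auto simp: pure_tensor_def fscale_def H.carrier_scale H.inner_scale_left algebra_simps)
qed simp

lemma pure_onb:
  assumes "ordered_onb H as" "ordered_onb K bs" "x \<in> hcarrier H" "y \<in> hcarrier K"
  shows "pure x y = (\<Sum>i<length as. \<Sum>j<length bs.
    fscale (pure x y (as ! i) (bs ! j)) (pure (as ! i) (bs ! j)))"
proof (intro ext)
  fix h k
  have as: "as ! i \<in> hcarrier H" if "i < length as" for i
    using assms(1) that by (auto simp: ordered_onb_def)
  have bs: "bs ! j \<in> hcarrier K" if "j < length bs" for j
    using assms(2) that by (auto simp: ordered_onb_def)
  show "pure x y h k = (\<Sum>i<length as. \<Sum>j<length bs.
    fscale (pure x y (as ! i) (bs ! j)) (pure (as ! i) (bs ! j))) h k"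
  proof (cases "h \<in> hcarrier H \<and> k \<in> hcarrier K")
    case True
    have "hinner H h x = (\<Sum>i<length as. hinner H (as ! i) x * hinner H h (as ! i))"
    proof -
      have "hinner H h (\<Sum>k<length as. hscale H (hinner H (as ! k) x) (as ! k))
          = (\<Sum>k<length as. hinner H (as ! k) x * hinner H h (as ! k))"
        using True by (subst H.inner_sum) (auto simp: H.inner_scale H.carrier_scale as)
      then show ?thesis using H.onb_expansion[OF assms(1,3)] by simp
    qed
    moreover have "hinner K k y = (\<Sum>j<length bs. hinner K (bs ! j) y * hinner K k (bs ! j))"
    proof -
      have "hinner K k (\<Sum>j<length bs. hscale K (hinner K (bs ! j) y) (bs ! j))
          = (\<Sum>j<length bs. hinner K (bs ! j) y * hinner K k (bs ! j))"
        using True by (subst K.inner_sum) (auto simp: K.inner_scale K.carrier_scale bs)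
      then show ?thesis using K.onb_expansion[OF assms(2,4)] by simp
    qed
    ultimately show ?thesis using True as bs assms
      by (auto simp: sum_fun_apply pure_tensor_def fscale_def sum_product algebra_simps
          intro!: sum.cong)
  qed (auto simp: sum_fun_apply pure_tensor_def fscale_def)
qed

lemma T_onb:
  assumes "ordered_onb H as" "ordered_onb K bs" "f \<in> T"
  shows "f = (\<Sum>i<length as. \<Sum>j<length bs. fscale (f (as ! i) (bs ! j)) (pure (as ! i) (bs ! j)))"
  using assms(3) unfolding T_def'
proof (induction rule: F.span_induct_alt)
  case base
  show ?case by (simp add: fun_eq_iff sum_fun_apply fscale_def)
next
  case (step c g f)
  then obtain x y where g: "g = pure x y" "x \<in> hcarrier H" "y \<in> hcarrier K" by blast
  have *: "g h k = (\<Sum>i<length as. \<Sum>j<length bs.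
      g (as ! i) (bs ! j) * pure (as ! i) (bs ! j) h k)" for h k
    using fun_cong[OF fun_cong[OF pure_onb[OF assms(1,2) g(2,3)]], of h k] unfolding g(1)
    by (simp add: sum_fun_apply fscale_def)
  have **: "f h k = (\<Sum>i<length as. \<Sum>j<length bs.
      f (as ! i) (bs ! j) * pure (as ! i) (bs ! j) h k)" for h k
    using fun_cong[OF fun_cong[OF step(2)], of h k]
    by (simp add: sum_fun_apply fscale_def)
  show ?case
  proof (intro ext)
    fix h k
    have "(fscale c g + f) h k = c * g h k + f h k" by (simp add: fscale_def)
    also have "\<dots> = (\<Sum>i<length as. \<Sum>j<length bs.
      (c * g (as ! i) (bs ! j) + f (as ! i) (bs ! j)) * pure (as ! i) (bs ! j) h k)"
      by (subst *, subst **) (simp add: sum_distrib_left distrib_right sum.distrib mult.assoc)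
    finally show "(fscale c g + f) h k = (\<Sum>i<length as. \<Sum>j<length bs.
      fscale ((fscale c g + f) (as ! i) (bs ! j)) (pure (as ! i) (bs ! j))) h k"
      by (simp add: sum_fun_apply fscale_def)
  qed
qed

lemma tensor_inner_pos:
  assumes f: "f \<in> T" "f \<noteq> 0"
  shows "0 < Re (tensor_inner H K f f)"
proof -
  obtain as bs where on: "ordered_onb H as" "ordered_onb K bs"
    using H.ordered_onb_exists K.ordered_onb_exists by blast
  have as: "as ! i \<in> hcarrier H" if "i < length as" for i
    using on(1) that by (auto simp: ordered_onb_def)
  have bs: "bs ! j \<in> hcarrier K" if "j < length bs" for j
    using on(2) that by (auto simp: ordered_onb_def)
  define c where "c i j = f (as ! i) (bs ! j)" for i j
  define I where "I = List.product [0..<length as] [0..<length bs]"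
  have I: "sum_list (map F I) = (\<Sum>i<length as. \<Sum>j<length bs. F (i, j))"
    for F :: "nat \<times> nat \<Rightarrow> 'c::comm_monoid_add"
  proof -
    have "sum_list (map F I) = sum F (set I)"
      by (intro sum_list_distinct_conv_sum_set) (simp add: I_def distinct_product)
    also have "set I = {..<length as} \<times> {..<length bs}" by (auto simp: I_def)
    also have "sum F \<dots> = (\<Sum>i<length as. \<Sum>j<length bs. F (i, j))"
      by (simp add: sum.cartesian_product)
    finally show ?thesis .
  qed
  define ps where "ps = map (\<lambda>(i, j). (hscale H (c i j) (as ! i), bs ! j)) I"
  have ps: "set ps \<subseteq> pairs"
    by (auto simp: ps_def I_def as bs H.carrier_scale)
  have pc: "fscale d (pure x y) = pure (hscale H d x) y" if "x \<in> hcarrier H" for d x y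
    using that by (auto simp: fun_eq_iff fscale_def pure_tensor_def H.inner_scale)
  have "f = (\<Sum>i<length as. \<Sum>j<length bs. fscale (c i j) (pure (as ! i) (bs ! j)))"
    using T_onb[OF on f(1)] by (simp add: c_def)
  also have "\<dots> = (\<Sum>(x, y)\<leftarrow>ps. pure x y)"
    by (simp add: ps_def o_def case_prod_unfold I pc as)
  finally have "tensor_inner H K f f = (\<Sum>(x, y)\<leftarrow>ps. cnj (f x y))"
    by (rule tensor_inner_eq[OF f(1) ps])
  also have "\<dots> = (\<Sum>i<length as. \<Sum>j<length bs. c i j * cnj (c i j))"
    by (simp add: ps_def o_def case_prod_unfold I T_antilinear[OF f(1)] as bs c_def)
  finally have eq: "Re (tensor_inner H K f f) =
      (\<Sum>i<length as. \<Sum>j<length bs. (cmod (c i j))\<^sup>2)"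
    by (simp add: complex_mult_cnj cmod_power2)
  have "\<exists>i<length as. \<exists>j<length bs. c i j \<noteq> 0"
  proof (rule ccontr)
    assume "\<not> ?thesis"
    then have "f = (\<Sum>i<length as. \<Sum>j<length bs. fscale 0 (pure (as ! i) (bs ! j)))"
      using T_onb[OF on f(1)] by (simp add: c_def)
    also have "\<dots> = 0" by (simp add: fun_eq_iff sum_fun_apply fscale_def)
    finally show False using f(2) by simp
  qed
  then obtain i j where "i < length as" "j < length bs" "c i j \<noteq> 0" by blast
  then show ?thesis unfolding eq
    by (intro sum_pos2[of _ i] sum_pos2[of _ j] sum_nonneg) auto
qed

lemma fd_hilbert_tensor: "fd_hilbert (tensor H K)"
proof -
  have hs: "hscale (tensor H K) = fscale" and hi: "hinner (tensor H K) = tensor_inner H K"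
    by (simp_all add: tensor_def)
  obtain as bs where on: "ordered_onb H as" "ordered_onb K bs"
    using H.ordered_onb_exists K.ordered_onb_exists by blast
  let ?E = "(\<lambda>(a, b). pure a b) ` (set as \<times> set bs)"
  have sub: "set as \<subseteq> hcarrier H" "set bs \<subseteq> hcarrier K" using on by (auto simp: ordered_onb_def)
  have "F.span ?E = T"
  proof
    show "F.span ?E \<subseteq> T"
      by (rule F.span_minimal[OF _ subspace_T]) (use sub in \<open>auto intro: pure_in_T\<close>)
    show "T \<subseteq> F.span ?E"
    proof
      fix f assume "f \<in> T"
      from T_onb[OF on this] show "f \<in> F.span ?E"
        by (rule ssubst) (intro F.span_sum F.span_scale F.span_base; force)
    qed
  qed
  then have fin: "\<exists>B. finite B \<and> F.span B = T" by (intro exI[of _ ?E]) simp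
  show ?thesis
  proof (rule fd_hilbert.intro)
    show "vector_space (hscale (tensor H K))" by (simp add: hs F.vector_space_axioms)
    show "fd_hilbert_axioms (tensor H K)"
      unfolding fd_hilbert_axioms_def hs hi
    proof (intro conjI allI impI)
      show "F.subspace T" by (rule subspace_T)
      show "\<exists>B. finite B \<and> F.span B = T" by (rule fin)
      show "0 < Re (tensor_inner H K x x)" if "x \<in> T" "x \<noteq> 0" for x
        using that by (rule tensor_inner_pos)
    next
      fix f g c assume fg: "f \<in> T" "g \<in> T"
      obtain ps where ps: "set ps \<subseteq> pairs" "f = (\<Sum>(x, y)\<leftarrow>ps. pure x y)"
        using T_decomposition fg(1) by blast
      have L: "tensor_inner H K f g = (\<Sum>(x, y)\<leftarrow>ps. g x y)" if "g \<in> T" for g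
        using tensor_inner_eq'[OF that ps] .
      show "tensor_inner H K f (fscale c g) = c * tensor_inner H K f g"
        using L[OF fg(2)] L[OF F.subspace_scale[OF subspace_T fg(2)]]
        by (simp add: fscale_def case_prod_unfold sum_list_const_mult)
      have "tensor_inner H K g f = (\<Sum>(x, y)\<leftarrow>ps. cnj (g x y))"
        by (rule tensor_inner_eq[OF fg(2) ps])
      also have "\<dots> = cnj (\<Sum>(x, y)\<leftarrow>ps. g x y)" by (induction ps) auto
      finally show "tensor_inner H K g f = cnj (tensor_inner H K f g)"
        using L[OF fg(2)] by simp
    next
      fix f g h assume fg: "f \<in> T" "g \<in> T" "h \<in> T"
      obtain ps where ps: "set ps \<subseteq> pairs" "f = (\<Sum>(x, y)\<leftarrow>ps. pure x y)"
        using T_decomposition fg(1) by blast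
      show "tensor_inner H K f (g + h) = tensor_inner H K f g + tensor_inner H K f h"
        using tensor_inner_eq'[OF fg(2) ps] tensor_inner_eq'[OF fg(3) ps]
          tensor_inner_eq'[OF F.subspace_add[OF subspace_T fg(2,3)] ps]
        by (simp add: case_prod_unfold sum_list_addf)
    qed
  qed
qed

end

lemma adjoint_unique:
  assumes "fd_hilbert H"
    and g: "g \<in> hlinear K H" "\<forall>x\<in>hcarrier H. \<forall>y\<in>hcarrier K. \<phi> x y = hinner H x (g y)"
    and g': "g' \<in> hlinear K H" "\<forall>x\<in>hcarrier H. \<forall>y\<in>hcarrier K. \<phi> x y = hinner H x (g' y)"
  shows "g' = g"
proof
  interpret H: fd_hilbert H by fact
  fix y
  show "g' y = g y"
  proof (cases "y \<in> hcarrier K")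
    case True
    then have c: "g y \<in> hcarrier H" "g' y \<in> hcarrier H"
      using g(1) g'(1) by (auto simp: hlinear_def)
    then have "hinner H (g' y - g y) (g' y - g y) = 0"
      using g(2) g'(2) True by (simp add: H.inner_diff H.carrier_diff)
    then have "g' y - g y = 0" using H.inner_self_eq_0 H.carrier_diff c by blast
    then show ?thesis by simp
  qed (use g(1) g'(1) in \<open>auto simp: hlinear_def PiE_def extensional_def\<close>)
qed

lemma hadjoint:
  assumes "fd_hilbert H" "fd_hilbert K" "f \<in> hlinear H K"
  shows "hadjoint H K f \<in> hlinear K H"
    and "\<And>x y. x \<in> hcarrier H \<Longrightarrow> y \<in> hcarrier K
      \<Longrightarrow> hinner K (f x) y = hinner H x (hadjoint H K f y)"
proof -
  interpret H: fd_hilbert H by fact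
  interpret K: fd_hilbert K by fact
  obtain as where on: "ordered_onb H as" using H.ordered_onb_exists by blast
  have as: "as ! i \<in> hcarrier H" if "i < length as" for i
    using on that by (auto simp: ordered_onb_def)
  have f: "f x \<in> hcarrier K" if "x \<in> hcarrier H" for x
    using assms(3) that by (auto simp: hlinear_def)
  have f_add: "f (x + y) = f x + f y" if "x \<in> hcarrier H" "y \<in> hcarrier H" for x y
    using assms(3) that by (auto simp: hlinear_def)
  have f_scale: "f (hscale H c x) = hscale K c (f x)" if "x \<in> hcarrier H" for c x
    using assms(3) that by (auto simp: hlinear_def)
  define g where "g = (\<lambda>y\<in>hcarrier K.
    \<Sum>k<length as. hscale H (hinner K (f (as ! k)) y) (as ! k))"
  have gl: "g \<in> hlinear K H"
    unfolding hlinear_def g_def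
    by (auto simp: K.carrier_add K.carrier_scale K.inner_add K.inner_scale f as
        H.scale_left_distrib sum.distrib H.scale_sum_right intro!: H.carrier_sum H.carrier_scale)
  have ga: "hinner K (f x) y = hinner H x (g y)"
    if x: "x \<in> hcarrier H" and y: "y \<in> hcarrier K" for x y
  proof -
    let ?S = "{z \<in> hcarrier H. hinner K (f z) y = hinner H z (g y)}"
    have gy: "g y \<in> hcarrier H" using gl y by (auto simp: hlinear_def)
    have "f (hscale H 0 x) = hscale K 0 (f x)" using x by (rule f_scale)
    then have f0: "f 0 = 0" by simp
    have S: "H.subspace ?S"
      by (rule H.subspaceI)
        (auto simp: H.carrier_0 H.carrier_add H.carrier_scale f_add f_scale f gy y f0
          H.inner_0_left K.inner_0_left H.inner_add_left K.inner_add_left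
          H.inner_scale_left K.inner_scale_left)
    have "as ! i \<in> ?S" if i: "i < length as" for i
    proof -
      have "hinner H (as ! i) (g y)
          = (\<Sum>k<length as. hinner K (f (as ! k)) y * (if i = k then 1 else 0))"
        using i y on unfolding g_def
        by (simp, subst H.inner_sum)
          (auto simp: as H.carrier_scale H.inner_scale ordered_onb_def)
      also have "\<dots> = hinner K (f (as ! i)) y"
        using i by (simp add: if_distrib[of "(*) _"] cong: if_cong)
      finally show ?thesis using as i by simp
    qed
    then have "set as \<subseteq> ?S" by (auto simp: in_set_conv_nth)
    then have "H.span (set as) \<subseteq> ?S" using S by (rule H.span_minimal)
    then show ?thesis using x on by (auto simp: ordered_onb_def)
  qed
  let ?P = "\<lambda>g. g \<in> hlinear K H \<and>
    (\<forall>x\<in>hcarrier H. \<forall>y\<in>hcarrier K. hinner K (f x) y = hinner H x (g y))"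
  have g: "?P g" using gl ga by blast
  have "?P (hadjoint H K f)" unfolding hadjoint_def
  proof (rule theI[where P = ?P, OF g])
    fix g' assume g': "?P g'"
    show "g' = g"
      by (rule adjoint_unique[OF assms(1), where K = K and \<phi> = "\<lambda>x y. hinner K (f x) y"])
        (use g g' in blast)+
  qed
  then show "hadjoint H K f \<in> hlinear K H"
    and "\<And>x y. x \<in> hcarrier H \<Longrightarrow> y \<in> hcarrier K
      \<Longrightarrow> hinner K (f x) y = hinner H x (hadjoint H K f y)" by blast+
qed

lemma one_comp_one_cell:
  fixes X :: "'a::ab_group_add hilb mat" and Y :: "'b::ab_group_add hilb mat"
  assumes "X \<in> one_cells n m" "Y \<in> one_cells m k"
  shows "X ;; Y \<in> one_cells n k"
proof -
  have "vector_space (hscale (tensor A B))" for A :: "'b hilb" and B :: "'a hilb"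
    by (simp add: tensor_def vector_space_fscale)
  then show ?thesis
    using assms unfolding one_cells_def one_comp_def
    by (auto intro!: fd_hilbert_dsum tensor_pair.fd_hilbert_tensor tensor_pair.intro)
qed

lemma witness_one_cells: "W\<^sub>L n \<in> one_cells 1 n" "W\<^sub>R n \<in> one_cells n 1"
  by (auto simp: one_cells_def W\<^sub>L_def W\<^sub>R_def fd_hilbert_C)

lemma system_one_cell: "fd_hilbert H \<Longrightarrow> system H \<in> one_cells 1 1"
  by (auto simp: one_cells_def system_def)

lemma inverse_cell_unitary:
  assumes F: "F \<in> one_cells n m" and G: "G \<in> one_cells n m" and u: "unitary_cell F G \<mu>"
  shows "inverse_cell F G \<mu> = dagger F G \<mu>"
proof (rule eq_matI)
  fix i j assume "i < dim_row (dagger F G \<mu>)" "j < dim_col (dagger F G \<mu>)"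
  then have ij: "i < dim_row F" "j < dim_col F" by (auto simp: dagger_def)
  let ?H = "F $$ (i, j)" and ?K = "G $$ (i, j)" and ?f = "\<mu> $$ (i, j)"
  let ?g = "hadjoint ?H ?K ?f"
  have d: "dim_row G = dim_row F" "dim_col G = dim_col F" and f: "?f \<in> hlinear ?H ?K"
    using u ij by (auto simp: unitary_cell_def two_cells_def)
  have HK: "fd_hilbert ?H" "fd_hilbert ?K" using F G ij by (auto simp: one_cells_def)
  have g: "?g \<in> hlinear ?K ?H" using hadjoint(1)[OF HK f] .
  have "vcomp F (dagger F G \<mu>) \<mu> $$ (i, j) = id_cell F $$ (i, j)"
    using u by (simp add: unitary_cell_def)
  then have gf: "compose (hcarrier ?H) ?g ?f = (\<lambda>x\<in>hcarrier ?H. x)"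
    using ij by (simp add: vcomp_def dagger_def id_cell_def)
  have "vcomp G \<mu> (dagger F G \<mu>) $$ (i, j) = id_cell G $$ (i, j)"
    using u by (simp add: unitary_cell_def)
  then have fg: "compose (hcarrier ?K) ?f ?g = (\<lambda>x\<in>hcarrier ?K. x)"
    using ij d by (simp add: vcomp_def dagger_def id_cell_def)
  have inj: "inj_on ?f (hcarrier ?H)"
  proof (rule inj_on_inverseI)
    show "?g (?f x) = x" if "x \<in> hcarrier ?H" for x
      using fun_cong[OF gf, of x] that by (simp add: compose_def)
  qed
  have "(\<lambda>y\<in>hcarrier ?K. inv_into (hcarrier ?H) ?f y) = ?g"
  proof
    fix y
    show "(\<lambda>y\<in>hcarrier ?K. inv_into (hcarrier ?H) ?f y) y = ?g y"
    proof (cases "y \<in> hcarrier ?K")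
      case True
      then have "?f (?g y) = y" using fun_cong[OF fg, of y] by (simp add: compose_def)
      moreover have "?g y \<in> hcarrier ?H" using g True by (auto simp: hlinear_def)
      ultimately show ?thesis using True inv_into_f_eq[OF inj] by simp
    qed (use g in \<open>auto simp: hlinear_def PiE_def extensional_def\<close>)
  qed
  then show "inverse_cell F G \<mu> $$ (i, j) = dagger F G \<mu> $$ (i, j)"
    using ij by (simp add: inverse_cell_def dagger_def)
qed (auto simp: inverse_cell_def dagger_def)


section \<open>The coherence isomorphism identifying the witness composite with \<open>\<complex> \<oplus> \<dots> \<oplus> \<complex>\<close>\<close>

definition witness_coh :: "nat \<Rightarrow> (nat \<Rightarrow> complex \<Rightarrow> complex \<Rightarrow> complex) \<Rightarrow> nat \<Rightarrow> complex" where
  "witness_coh n = (\<lambda>f\<in>hcarrier ((W\<^sub>L n ;; W\<^sub>R n) $$ (0, 0)). \<lambda>j. f j 1 1)"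

lemma witness_entry: "(W\<^sub>L n ;; W\<^sub>R n) $$ (0, 0) = dsum n (\<lambda>_. tensor hilb_C hilb_C)"
proof -
  have "hscale (tensor A B) = fscale" for A B :: "complex hilb" by (simp add: tensor_def)
  then show ?thesis
    by (auto simp: one_comp_def W\<^sub>L_def W\<^sub>R_def dsum_def fun_eq_iff intro!: sum.cong)
qed

interpretation CC: tensor_pair hilb_C hilb_C
  by (intro tensor_pair.intro fd_hilbert_C)

lemma pure_CC: "pure_tensor hilb_C hilb_C z w = (\<lambda>h k. cnj h * z * (cnj k * w))"
  by (simp add: pure_tensor_def hilb_C_def)

lemma tensor_CC_carrier:
  "f \<in> hcarrier (tensor hilb_C hilb_C) \<longleftrightarrow> f = fscale (f 1 1) (pure_tensor hilb_C hilb_C 1 1)"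
proof
  interpret V: vector_space "(*) :: complex \<Rightarrow> complex \<Rightarrow> complex"
    by unfold_locales (auto simp: algebra_simps)
  have "x * 1 \<in> V.span {1}" for x :: complex
    by (intro V.span_scale V.span_base) simp
  then have on: "ordered_onb hilb_C [1]"
    by (auto simp: ordered_onb_def hilb_C_def)
  show "f = fscale (f 1 1) (pure_tensor hilb_C hilb_C 1 1)"
    if "f \<in> hcarrier (tensor hilb_C hilb_C)"
    by (rule trans[OF CC.T_onb[OF on on that]]) simp
next
  have "fscale (f 1 1) (pure_tensor hilb_C hilb_C 1 1) \<in> hcarrier (tensor hilb_C hilb_C)"
    by (rule CC.F.subspace_scale[OF CC.subspace_T CC.pure_in_T]) (simp_all add: hilb_C_def)
  then show "f = fscale (f 1 1) (pure_tensor hilb_C hilb_C 1 1)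
    \<Longrightarrow> f \<in> hcarrier (tensor hilb_C hilb_C)" by metis
qed

lemma tensor_CC_inner:
  assumes "f \<in> hcarrier (tensor hilb_C hilb_C)" "g \<in> hcarrier (tensor hilb_C hilb_C)"
  shows "hinner (tensor hilb_C hilb_C) f g = cnj (f 1 1) * g 1 1"
proof -
  have "g = pure_tensor hilb_C hilb_C 1 (g 1 1)"
    by (rule trans[OF tensor_CC_carrier[THEN iffD1, OF assms(2)]])
      (simp add: pure_CC fscale_def fun_eq_iff)
  then have "tensor_inner hilb_C hilb_C f g = (\<Sum>(x, y)\<leftarrow>[(1, g 1 1)]. cnj (f x y))"
    by (intro CC.tensor_inner_eq assms) (simp_all add: hilb_C_def)
  moreover have "f 1 (g 1 1) = f 1 1 * cnj (g 1 1)"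
    by (rule trans[OF fun_cong[OF fun_cong[OF tensor_CC_carrier[THEN iffD1, OF assms(1)]]]])
      (simp add: pure_CC fscale_def)
  ultimately show ?thesis by (simp add: tensor_def)
qed

lemma witness_coherence:
  "witness_coh n \<in> hlinear ((W\<^sub>L n ;; W\<^sub>R n) $$ (0, 0)) (dsum n (\<lambda>_. hilb_C))"
  "bij_betw (witness_coh n) (hcarrier ((W\<^sub>L n ;; W\<^sub>R n) $$ (0, 0)))
     (hcarrier (dsum n (\<lambda>_. hilb_C)))"
  "\<lbrakk>f \<in> hcarrier ((W\<^sub>L n ;; W\<^sub>R n) $$ (0, 0)); g \<in> hcarrier ((W\<^sub>L n ;; W\<^sub>R n) $$ (0, 0))\<rbrakk>
    \<Longrightarrow> hinner (dsum n (\<lambda>_. hilb_C)) (witness_coh n f) (witness_coh n g)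
      = hinner ((W\<^sub>L n ;; W\<^sub>R n) $$ (0, 0)) f g"
  "i < n \<Longrightarrow> witness_coh n (dsum_incl i (pure_tensor hilb_C hilb_C z w)) = dsum_incl i (z * w)"
proof -
  let ?T = "hcarrier (tensor hilb_C hilb_C)"
  have D: "f \<in> hcarrier ((W\<^sub>L n ;; W\<^sub>R n) $$ (0, 0))
      \<longleftrightarrow> (\<forall>j<n. f j \<in> ?T) \<and> (\<forall>j\<ge>n. f j = 0)" for f
    by (simp add: witness_entry dsum_def)
  have E: "g \<in> hcarrier (dsum n (\<lambda>_. hilb_C)) \<longleftrightarrow> (\<forall>j\<ge>n. g j = 0)" for g
    by (simp add: dsum_def hilb_C_def)
  interpret S: fd_hilbert "(W\<^sub>L n ;; W\<^sub>R n) $$ (0, 0)"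
    unfolding witness_entry
    using CC.fd_hilbert_tensor by (intro fd_hilbert_dsum) (auto dest: fd_hilbert.axioms(1))
  have sc: "hscale ((W\<^sub>L n ;; W\<^sub>R n) $$ (0, 0)) c f = (\<lambda>j h k. c * f j h k)" for c f
    by (simp add: witness_entry dsum_def tensor_def fscale_def)
  show "witness_coh n \<in> hlinear ((W\<^sub>L n ;; W\<^sub>R n) $$ (0, 0)) (dsum n (\<lambda>_. hilb_C))"
  proof -
    have "witness_coh n \<in> hcarrier ((W\<^sub>L n ;; W\<^sub>R n) $$ (0, 0))
        \<rightarrow>\<^sub>E hcarrier (dsum n (\<lambda>_. hilb_C))"
      by (auto simp: witness_coh_def D E)
    moreover have "witness_coh n (x + y) = witness_coh n x + witness_coh n y"
      if "x \<in> hcarrier ((W\<^sub>L n ;; W\<^sub>R n) $$ (0, 0))"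
        "y \<in> hcarrier ((W\<^sub>L n ;; W\<^sub>R n) $$ (0, 0))" for x y
      unfolding witness_coh_def using that S.carrier_add[OF that] by (simp add: fun_eq_iff)
    moreover have "witness_coh n (hscale ((W\<^sub>L n ;; W\<^sub>R n) $$ (0, 0)) c x)
        = hscale (dsum n (\<lambda>_. hilb_C)) c (witness_coh n x)"
      if "x \<in> hcarrier ((W\<^sub>L n ;; W\<^sub>R n) $$ (0, 0))" for c x
      unfolding witness_coh_def using that S.carrier_scale[OF that, of c]
      by (simp add: sc) (simp add: dsum_def hilb_C_def)
    ultimately show ?thesis unfolding hlinear_def by blast
  qed
  show "bij_betw (witness_coh n) (hcarrier ((W\<^sub>L n ;; W\<^sub>R n) $$ (0, 0)))
     (hcarrier (dsum n (\<lambda>_. hilb_C)))"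
  proof (rule bij_betw_byWitness[where
        f' = "\<lambda>g j. fscale (g j) (pure_tensor hilb_C hilb_C 1 1)"])
    show "\<forall>f\<in>hcarrier ((W\<^sub>L n ;; W\<^sub>R n) $$ (0, 0)).
        (\<lambda>j. fscale (witness_coh n f j) (pure_tensor hilb_C hilb_C 1 1)) = f"
    proof (intro ballI ext)
      fix f j h k
      assume f: "f \<in> hcarrier ((W\<^sub>L n ;; W\<^sub>R n) $$ (0, 0))"
      show "fscale (witness_coh n f j) (pure_tensor hilb_C hilb_C 1 1) h k = f j h k"
      proof (cases "j < n")
        case True
        then have "f j \<in> ?T" using f D by blast
        then have "f j = fscale (f j 1 1) (pure_tensor hilb_C hilb_C 1 1)"
          by (rule tensor_CC_carrier[THEN iffD1])
        from this[symmetric] show ?thesis using f by (simp add: witness_coh_def)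
      next
        case False
        then have "f j = 0" using f D by simp
        then show ?thesis using f by (simp add: witness_coh_def fscale_def)
      qed
    qed
    have inT: "fscale c (pure_tensor hilb_C hilb_C 1 1) \<in> ?T" for c
      by (rule CC.F.subspace_scale[OF CC.subspace_T CC.pure_in_T]) (simp_all add: hilb_C_def)
    have mem: "(\<lambda>j. fscale (g j) (pure_tensor hilb_C hilb_C 1 1))
        \<in> hcarrier ((W\<^sub>L n ;; W\<^sub>R n) $$ (0, 0))" if "g \<in> hcarrier (dsum n (\<lambda>_. hilb_C))" for g
      using that inT by (auto simp: D E fscale_def fun_eq_iff)
    then show "(\<lambda>g j. fscale (g j) (pure_tensor hilb_C hilb_C 1 1)) `
        hcarrier (dsum n (\<lambda>_. hilb_C)) \<subseteq> hcarrier ((W\<^sub>L n ;; W\<^sub>R n) $$ (0, 0))" by blast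
    show "\<forall>g\<in>hcarrier (dsum n (\<lambda>_. hilb_C)).
        witness_coh n (\<lambda>j. fscale (g j) (pure_tensor hilb_C hilb_C 1 1)) = g"
      using mem by (simp add: witness_coh_def) (simp add: pure_CC fscale_def)
    show "witness_coh n ` hcarrier ((W\<^sub>L n ;; W\<^sub>R n) $$ (0, 0))
        \<subseteq> hcarrier (dsum n (\<lambda>_. hilb_C))"
      by (auto simp: witness_coh_def D E)
  qed
  show "hinner (dsum n (\<lambda>_. hilb_C)) (witness_coh n f) (witness_coh n g)
      = hinner ((W\<^sub>L n ;; W\<^sub>R n) $$ (0, 0)) f g"
    if "f \<in> hcarrier ((W\<^sub>L n ;; W\<^sub>R n) $$ (0, 0))" "g \<in> hcarrier ((W\<^sub>L n ;; W\<^sub>R n) $$ (0, 0))"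
  proof -
    have "hinner ((W\<^sub>L n ;; W\<^sub>R n) $$ (0, 0)) f g
        = (\<Sum>j<n. hinner (tensor hilb_C hilb_C) (f j) (g j))"
      by (simp add: witness_entry dsum_def)
    also have "\<dots> = (\<Sum>j<n. cnj (f j 1 1) * g j 1 1)"
      using that by (intro sum.cong tensor_CC_inner) (auto simp: D)
    finally show ?thesis using that by (simp add: witness_coh_def) (simp add: dsum_def hilb_C_def)
  qed
  show "witness_coh n (dsum_incl i (pure_tensor hilb_C hilb_C z w)) = dsum_incl i (z * w)"
    if "i < n"
  proof -
    have "pure_tensor hilb_C hilb_C z w \<in> ?T"
      by (rule CC.pure_in_T) (simp_all add: hilb_C_def)
    moreover have "0 \<in> ?T" by (rule CC.F.subspace_0[OF CC.subspace_T])
    ultimately have "dsum_incl i (pure_tensor hilb_C hilb_C z w)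
        \<in> hcarrier ((W\<^sub>L n ;; W\<^sub>R n) $$ (0, 0))"
      using that by (simp add: D dsum_incl_def zero_fun_def)
    then have "witness_coh n (dsum_incl i (pure_tensor hilb_C hilb_C z w))
        = (\<lambda>j. dsum_incl i (pure_tensor hilb_C hilb_C z w) j 1 1)"
      by (simp add: witness_coh_def)
    also have "\<dots> = dsum_incl i (z * w)"
    proof
      fix j
      show "dsum_incl i (pure_tensor hilb_C hilb_C z w) j 1 1 = dsum_incl i (z * w) j"
        by (cases "j = i") (simp_all add: dsum_incl_def pure_CC)
    qed
    finally show ?thesis .
  qed
qed

lemma witness_coherence_std: "i < n \<Longrightarrow> witness_coh n (witness_std i) = dsum_incl i 1"
  by (simp add: witness_std_def witness_coherence(4))

end

theory Submission
  imports Defs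
begin

text \<open>
  A unitary between finite-dimensional Hilbert spaces is the same as a matching of orthonormal
  bases: once an ordered orthonormal basis \<open>(e\<^sub>1, \<dots>, e\<^sub>n)\<close> of \<open>K\<close> is fixed, a unitary
  \<open>u : H \<rightarrow> K\<close> is determined by the vectors \<open>a\<^sub>i = u\<^sup>-\<^sup>1 e\<^sub>i\<close>, which form an ordered orthonormal basis
  of \<open>H\<close>, and every such basis arises.  Indeed \<open>u\<close> is recovered from the \<open>a\<^sub>i\<close> by the Fourier
  expansion \<open>u x = \<Sum>\<^sub>i \<langle>e\<^sub>i, u x\<rangle> e\<^sub>i = \<Sum>\<^sub>i \<langle>a\<^sub>i, x\<rangle> e\<^sub>i\<close>, and for arbitrary orthonormal bases the
  right-hand side is a unitary, whose inverse is the same expression with the two bases exchanged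
  (lemma \<open>unitaries_bij_onbs\<close>).

  A measurement is a 1-by-1 matrix with such a unitary as its entry.  The definition of a unitary
  2-cell asks that the entry be inverse to its adjoint, which amounts to being a bijective isometry
  (lemma \<open>inverse_to_adjoint_iff\<close>).  The target is the literal entry of the composite of the
  witness 1-cells, a sum of \<open>n\<close> copies of \<open>\<complex> \<otimes> \<complex>\<close>, in which the vectors \<open>witness_std i\<close> form an
  orthonormal basis (lemma \<open>witness_std_onb\<close>) that plays the role of the \<open>e\<^sub>i\<close>.
\<close>

section \<open>Unitary maps\<close>

definition unitary_maps :: "'a::ab_group_add hilb \<Rightarrow> 'b::ab_group_add hilb \<Rightarrow> ('a \<Rightarrow> 'b) set" where
  "unitary_maps H K = {u \<in> hlinear H K. bij_betw u (hcarrier H) (hcarrier K) \<and>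
     (\<forall>x\<in>hcarrier H. \<forall>y\<in>hcarrier H. hinner K (u x) (u y) = hinner H x y)}"

lemma hlinear_mem: "f \<in> hlinear H K \<Longrightarrow> x \<in> hcarrier H \<Longrightarrow> f x \<in> hcarrier K"
  by (auto simp: hlinear_def)

lemma hlinear_sum_scale:
  assumes "fd_hilbert H" "fd_hilbert K" "f \<in> hlinear H K"
    and "\<And>i. i \<in> I \<Longrightarrow> v i \<in> hcarrier H"
  shows "f (\<Sum>i\<in>I. hscale H (c i) (v i)) = (\<Sum>i\<in>I. hscale K (c i) (f (v i)))"
proof -
  interpret H: fd_hilbert H by fact
  interpret K: fd_hilbert K by fact
  have add: "f (x + y) = f x + f y" if "x \<in> hcarrier H" "y \<in> hcarrier H" for x y
    using assms(3) that by (auto simp: hlinear_def)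
  have scale: "f (hscale H c x) = hscale K c (f x)" if "x \<in> hcarrier H" for c x
    using assms(3) that by (auto simp: hlinear_def)
  have zero: "f 0 = 0" using add[of 0 0] H.carrier_0 by simp
  show ?thesis using assms(4)
    by (induction I rule: infinite_finite_induct)
       (auto simp: zero add scale H.carrier_sum H.carrier_scale)
qed

text \<open>
  If \<open>u\<close> is inverse to its adjoint then \<open>\<langle>u x, u y\<rangle> = \<langle>x, u\<^sup>\<dagger> (u y)\<rangle> = \<langle>x, y\<rangle>\<close>.  Conversely, for a
  bijective isometry \<open>x - u\<^sup>\<dagger> (u x)\<close> is orthogonal to the whole of \<open>H\<close>, so \<open>u\<^sup>\<dagger>\<close> is a left inverse,
  and it is also a right inverse since \<open>u\<close> is onto.
\<close>

lemma inverse_to_adjoint_iff: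
  assumes "fd_hilbert H" "fd_hilbert K" and u: "u \<in> hlinear H K"
  shows "compose (hcarrier H) (hadjoint H K u) u = (\<lambda>x\<in>hcarrier H. x) \<and>
      compose (hcarrier K) u (hadjoint H K u) = (\<lambda>y\<in>hcarrier K. y) \<longleftrightarrow> u \<in> unitary_maps H K"
    (is "?L \<longleftrightarrow> _")
proof -
  interpret H: fd_hilbert H by fact
  let ?g = "hadjoint H K u"
  note adj = hadjoint(2)[OF assms]
  have um: "u x \<in> hcarrier K" if "x \<in> hcarrier H" for x using hlinear_mem[OF u that] .
  have gm: "?g y \<in> hcarrier H" if "y \<in> hcarrier K" for y
    using hlinear_mem[OF hadjoint(1)[OF assms] that] .
  have L: "?L \<longleftrightarrow> (\<forall>x\<in>hcarrier H. ?g (u x) = x) \<and> (\<forall>y\<in>hcarrier K. u (?g y) = y)"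
    by (auto simp: compose_def fun_eq_iff restrict_def)
  show ?thesis
  proof
    assume ?L
    then have gu: "\<And>x. x \<in> hcarrier H \<Longrightarrow> ?g (u x) = x"
      and ug: "\<And>y. y \<in> hcarrier K \<Longrightarrow> u (?g y) = y" using L by auto
    have "bij_betw u (hcarrier H) (hcarrier K)"
      by (rule bij_betw_byWitness[where f' = ?g]) (auto simp: gu ug um gm)
    moreover have "hinner K (u x) (u y) = hinner H x y"
      if "x \<in> hcarrier H" "y \<in> hcarrier H" for x y
      using that by (simp add: adj um gu)
    ultimately show "u \<in> unitary_maps H K" using u by (simp add: unitary_maps_def)
  next
    assume "u \<in> unitary_maps H K"
    then have bij: "bij_betw u (hcarrier H) (hcarrier K)"
      and iso: "\<And>x y. x \<in> hcarrier H \<Longrightarrow> y \<in> hcarrier H \<Longrightarrow> hinner K (u x) (u y) = hinner H x y"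
      by (auto simp: unitary_maps_def)
    have gu: "?g (u x) = x" if x: "x \<in> hcarrier H" for x
    proof -
      let ?d = "x - ?g (u x)"
      have g: "?g (u x) \<in> hcarrier H" and d: "?d \<in> hcarrier H"
        using x by (simp_all add: um gm H.carrier_diff)
      have "hinner H ?d ?d = 0"
        using iso[OF d x] adj[OF d um[OF x]] by (simp add: H.inner_diff[OF d x g])
      then show ?thesis using H.inner_self_eq_0[OF d] by simp
    qed
    have "u (?g y) = y" if y: "y \<in> hcarrier K" for y
    proof -
      obtain x where "x \<in> hcarrier H" "y = u x"
        using bij y by (auto simp: bij_betw_def)
      then show ?thesis by (simp add: gu)
    qed
    then show ?L using L gu by blast
  qed
qed


section \<open>Unitary maps and orthonormal bases\<close>

text \<open>
  The linear map with \<open>as ! k \<mapsto> es ! k\<close>, written through Fourier coefficients so that exchanging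
  the two bases gives its inverse.
\<close>

definition onb_map :: "'a::ab_group_add hilb \<Rightarrow> 'b::ab_group_add hilb
    \<Rightarrow> 'a list \<Rightarrow> 'b list \<Rightarrow> 'a \<Rightarrow> 'b" where
  "onb_map H K as es =
     (\<lambda>x\<in>hcarrier H. \<Sum>k<length es. hscale K (hinner H (as ! k) x) (es ! k))"

lemma onb_mem: "ordered_onb H as \<Longrightarrow> k < length as \<Longrightarrow> as ! k \<in> hcarrier H"
  by (auto simp: ordered_onb_def)

lemma onb_inner: "ordered_onb H as \<Longrightarrow> i < length as \<Longrightarrow> j < length as
    \<Longrightarrow> hinner H (as ! i) (as ! j) = (if i = j then 1 else 0)"
  by (auto simp: ordered_onb_def)

lemma onb_map_hlinear:
  assumes "fd_hilbert H" "fd_hilbert K" "ordered_onb H as" "ordered_onb K es"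
    and len: "length as = length es"
  shows "onb_map H K as es \<in> hlinear H K"
proof -
  interpret H: fd_hilbert H by fact
  interpret K: fd_hilbert K by fact
  have as: "as ! k \<in> hcarrier H" if "k < length es" for k
    using onb_mem[OF assms(3)] that len by simp
  have es: "es ! k \<in> hcarrier K" if "k < length es" for k
    using onb_mem[OF assms(4)] that by simp
  show ?thesis
    unfolding hlinear_def onb_map_def
    by (auto simp: H.carrier_add H.carrier_scale H.inner_add H.inner_scale as es
        K.scale_left_distrib sum.distrib K.scale_sum_right intro!: K.carrier_sum K.carrier_scale)
qed

lemma onb_map_nth:
  assumes "fd_hilbert K" "ordered_onb H as" "length as = length es" "i < length es"
  shows "onb_map H K as es (as ! i) = es ! i"
proof -
  interpret K: fd_hilbert K by fact
  have "onb_map H K as es (as ! i)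
      = (\<Sum>k<length es. hscale K (if k = i then 1 else 0) (es ! k))"
    using assms onb_mem[OF assms(2), of i] by (auto simp: onb_map_def onb_inner intro!: sum.cong)
  also have "\<dots> = (\<Sum>k<length es. if k = i then es ! k else 0)"
    by (intro sum.cong) auto
  also have "\<dots> = es ! i" using assms(4) by simp
  finally show ?thesis .
qed

text \<open>
  By linearity the outer map replaces each \<open>e\<^sub>k\<close> in \<open>\<Sum>\<^sub>k \<langle>a\<^sub>k, x\<rangle> e\<^sub>k\<close> by \<open>a\<^sub>k\<close>, which leaves the Fourier
  expansion of \<open>x\<close>.
\<close>

lemma onb_map_inverse:
  assumes "fd_hilbert H" "fd_hilbert K" "ordered_onb H as" "ordered_onb K es"
    and len: "length as = length es" and x: "x \<in> hcarrier H"
  shows "onb_map K H es as (onb_map H K as es x) = x"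
proof -
  have "onb_map K H es as (onb_map H K as es x)
      = (\<Sum>k<length es. hscale H (hinner H (as ! k) x) (onb_map K H es as (es ! k)))"
    using x hlinear_sum_scale[OF assms(2,1) onb_map_hlinear[OF assms(2,1,4,3) len[symmetric]],
        of "{..<length es}" "(!) es" "\<lambda>k. hinner H (as ! k) x"] onb_mem[OF assms(4)]
    by (simp add: onb_map_def[of H K])
  also have "\<dots> = (\<Sum>k<length as. hscale H (hinner H (as ! k) x) (as ! k))"
    using onb_map_nth[OF assms(1,4) len[symmetric]] len by (intro sum.cong) auto
  also have "\<dots> = x" using fd_hilbert.onb_expansion[OF assms(1,3) x] ..
  finally show ?thesis .
qed

lemma onb_map_unitary:
  assumes "fd_hilbert H" "fd_hilbert K" "ordered_onb H as" "ordered_onb K es"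
    and len: "length as = length es"
  shows "onb_map H K as es \<in> unitary_maps H K"
proof -
  interpret H: fd_hilbert H by fact
  interpret K: fd_hilbert K by fact
  let ?u = "onb_map H K as es"
  have lin: "?u \<in> hlinear H K" using onb_map_hlinear[OF assms] .
  have lin': "onb_map K H es as \<in> hlinear K H"
    using onb_map_hlinear[OF assms(2,1,4,3) len[symmetric]] .
  have es: "es ! k \<in> hcarrier K" if "k < length es" for k
    using onb_mem[OF assms(4)] that by simp
  have as: "as ! k \<in> hcarrier H" if "k < length es" for k
    using onb_mem[OF assms(3)] that len by simp
  have bij: "bij_betw ?u (hcarrier H) (hcarrier K)"
    using onb_map_inverse[OF assms] onb_map_inverse[OF assms(2,1,4,3) len[symmetric]]
      hlinear_mem[OF lin] hlinear_mem[OF lin']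
    by (intro bij_betw_byWitness[where f' = "onb_map K H es as"]) auto
  have coord: "hinner K (es ! i) (?u x) = hinner H (as ! i) x"
    if "i < length es" "x \<in> hcarrier H" for i x
  proof -
    have "hinner K (es ! i) (?u x)
        = (\<Sum>k<length es. hinner H (as ! k) x * (if i = k then 1 else 0))"
      using that onb_inner[OF assms(4)] unfolding onb_map_def
      by (simp, subst K.inner_sum) (auto simp: es K.carrier_scale K.inner_scale)
    also have "\<dots> = hinner H (as ! i) x"
      using that by (simp add: if_distrib[of "(*) _"] cong: if_cong)
    finally show ?thesis .
  qed
  have "hinner K (?u x) (?u y) = hinner H x y"
    if x: "x \<in> hcarrier H" and y: "y \<in> hcarrier H" for x y
  proof -
    have ux: "?u x \<in> hcarrier K" using hlinear_mem[OF lin x] .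
    have "hinner K (?u x) (?u y)
        = hinner K (?u x) (\<Sum>k<length es. hscale K (hinner H (as ! k) y) (es ! k))"
      using y by (simp add: onb_map_def)
    also have "\<dots> = (\<Sum>k<length es. hinner H (as ! k) y * hinner K (?u x) (es ! k))"
      using ux by (subst K.inner_sum) (auto simp: es K.carrier_scale K.inner_scale)
    also have "\<dots> = (\<Sum>k<length es. hinner H (as ! k) y * hinner H x (as ! k))"
      using x coord K.inner_commute[OF es ux] H.inner_commute[OF as x] by (intro sum.cong) auto
    also have "\<dots> = hinner H x (\<Sum>k<length as. hscale H (hinner H (as ! k) y) (as ! k))"
      using x as len by (subst H.inner_sum) (auto simp: H.inner_scale H.carrier_scale)
    also have "\<dots> = hinner H x y" using H.onb_expansion[OF assms(3) y] by simp
    finally show ?thesis .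
  qed
  then show ?thesis using lin bij by (simp add: unitary_maps_def)
qed

text \<open>
  The preimages \<open>a\<^sub>k\<close> are orthonormal because \<open>u\<close> is isometric.  They span because \<open>u\<close> takes
  \<open>\<Sum>\<^sub>k \<langle>a\<^sub>k, x\<rangle> a\<^sub>k\<close> to the Fourier expansion of \<open>u x\<close>, so that this sum is \<open>x\<close> by injectivity.
\<close>

lemma unitary_preimage_onb:
  assumes "fd_hilbert H" "fd_hilbert K" "ordered_onb K es" and u: "u \<in> unitary_maps H K"
  shows "ordered_onb H (map (inv_into (hcarrier H) u) es)"
proof -
  interpret H: fd_hilbert H by fact
  interpret K: fd_hilbert K by fact
  have lin: "u \<in> hlinear H K" and bij: "bij_betw u (hcarrier H) (hcarrier K)"
    and iso: "\<And>x y. x \<in> hcarrier H \<Longrightarrow> y \<in> hcarrier H \<Longrightarrow> hinner K (u x) (u y) = hinner H x y"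
    using u by (auto simp: unitary_maps_def)
  define a where "a k = inv_into (hcarrier H) u (es ! k)" for k
  have es: "es ! k \<in> hcarrier K" if "k < length es" for k
    using onb_mem[OF assms(3)] that by simp
  have a: "a k \<in> hcarrier H" and ua: "u (a k) = es ! k" if "k < length es" for k
    unfolding a_def using es[OF that] bij
    by (auto simp: bij_betw_def inv_into_into f_inv_into_f)
  have set: "set (map (inv_into (hcarrier H) u) es) = a ` {..<length es}"
    by (force simp: a_def set_conv_nth)
  have "x \<in> H.span (a ` {..<length es})" if x: "x \<in> hcarrier H" for x
  proof -
    let ?p = "\<Sum>k<length es. hscale H (hinner H (a k) x) (a k)"
    have "u ?p = (\<Sum>k<length es. hscale K (hinner H (a k) x) (u (a k)))"
      using a by (intro hlinear_sum_scale[OF assms(1,2) lin]) auto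
    also have "\<dots> = (\<Sum>k<length es. hscale K (hinner K (es ! k) (u x)) (es ! k))"
    proof (intro sum.cong refl)
      fix k assume "k \<in> {..<length es}"
      then show "hscale K (hinner H (a k) x) (u (a k))
          = hscale K (hinner K (es ! k) (u x)) (es ! k)"
        using iso[of "a k" x] a[of k] ua[of k] x by simp
    qed
    also have "\<dots> = u x"
      using K.onb_expansion[OF assms(3) hlinear_mem[OF lin x]] ..
    finally have "?p = x"
      using bij x a by (auto simp: bij_betw_def intro!: H.carrier_sum H.carrier_scale
          dest!: inj_onD)
    moreover have "?p \<in> H.span (a ` {..<length es})"
      by (intro H.span_sum H.span_scale H.span_base) auto
    ultimately show ?thesis by simp
  qed
  moreover have "H.span (a ` {..<length es}) \<subseteq> hcarrier H"
    using a by (intro H.span_minimal H.subspace_carrier) auto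
  moreover have "hinner H (a i) (a j) = (if i = j then 1 else 0)"
    if "i < length es" "j < length es" for i j
    using that iso[of "a i" "a j"] a ua onb_inner[OF assms(3)] by simp
  ultimately show ?thesis
    unfolding ordered_onb_def set using a by (auto simp flip: a_def)
qed

text \<open>
  Pulling back a fixed orthonormal basis is inverse to \<open>onb_map\<close>.  If the dimensions of \<open>H\<close> and \<open>K\<close>
  differ, both sets are empty.
\<close>

lemma unitaries_bij_onbs:
  assumes "fd_hilbert H" "fd_hilbert K" "ordered_onb K es"
  shows "bij_betw (\<lambda>u. map (inv_into (hcarrier H) u) es) (unitary_maps H K)
    {as. length as = length es \<and> ordered_onb H as}"
proof (rule bij_betw_byWitness[where f' = "\<lambda>as. onb_map H K as es"])
  show "\<forall>u\<in>unitary_maps H K. onb_map H K (map (inv_into (hcarrier H) u) es) es = u"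
  proof (intro ballI ext)
    fix u x assume u: "u \<in> unitary_maps H K"
    then have lin: "u \<in> hlinear H K" and bij: "bij_betw u (hcarrier H) (hcarrier K)"
      and iso: "\<And>x y. x \<in> hcarrier H \<Longrightarrow> y \<in> hcarrier H \<Longrightarrow> hinner K (u x) (u y) = hinner H x y"
      by (auto simp: unitary_maps_def)
    show "onb_map H K (map (inv_into (hcarrier H) u) es) es x = u x"
    proof (cases "x \<in> hcarrier H")
      case True
      have "hinner H (inv_into (hcarrier H) u (es ! k)) x = hinner K (es ! k) (u x)"
        if "k < length es" for k
        using iso[of "inv_into (hcarrier H) u (es ! k)" x] True bij onb_mem[OF assms(3) that]
        by (simp add: bij_betw_def inv_into_into f_inv_into_f)
      then have "onb_map H K (map (inv_into (hcarrier H) u) es) es x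
          = (\<Sum>k<length es. hscale K (hinner K (es ! k) (u x)) (es ! k))"
        using True by (simp add: onb_map_def)
      also have "\<dots> = u x"
        using fd_hilbert.onb_expansion[OF assms(2,3) hlinear_mem[OF lin True]] ..
      finally show ?thesis .
    qed (use lin in \<open>auto simp: onb_map_def hlinear_def PiE_def extensional_def\<close>)
  qed
  show "\<forall>as\<in>{as. length as = length es \<and> ordered_onb H as}.
      map (inv_into (hcarrier H) (onb_map H K as es)) es = as"
  proof
    fix as assume "as \<in> {as. length as = length es \<and> ordered_onb H as}"
    then have len: "length as = length es" and on: "ordered_onb H as" by auto
    have "inj_on (onb_map H K as es) (hcarrier H)"
      using onb_map_unitary[OF assms(1,2) on assms(3) len]
      by (simp add: unitary_maps_def bij_betw_def)
    then show "map (inv_into (hcarrier H) (onb_map H K as es)) es = as"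
      using len onb_mem[OF on] onb_map_nth[OF assms(2) on len]
      by (intro nth_equalityI) (auto intro!: inv_into_f_eq)
  qed
  show "(\<lambda>u. map (inv_into (hcarrier H) u) es) ` unitary_maps H K
      \<subseteq> {as. length as = length es \<and> ordered_onb H as}"
    using unitary_preimage_onb[OF assms] by auto
  show "(\<lambda>as. onb_map H K as es) ` {as. length as = length es \<and> ordered_onb H as}
      \<subseteq> unitary_maps H K"
    using onb_map_unitary[OF assms(1,2) _ assms(3)] by auto
qed


section \<open>The standard basis of the witness composite\<close>

lemma witness_fd_hilbert: "fd_hilbert ((W\<^sub>L n ;; W\<^sub>R n) $$ (0, 0))"
  using one_comp_one_cell[OF witness_one_cells, of n] by (auto simp: one_cells_def)

lemma witness_std_mem:
  assumes "i < n"
  shows "witness_std i \<in> hcarrier ((W\<^sub>L n ;; W\<^sub>R n) $$ (0, 0))"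
proof -
  have "pure_tensor hilb_C hilb_C 1 1 \<in> hcarrier (tensor hilb_C hilb_C)"
    by (rule CC.pure_in_T) (simp_all add: hilb_C_def)
  moreover have "0 \<in> hcarrier (tensor hilb_C hilb_C)"
    by (rule CC.F.subspace_0[OF CC.subspace_T])
  ultimately show ?thesis
    using assms by (simp add: witness_entry dsum_def witness_std_def dsum_incl_def zero_fun_def)
qed

text \<open>
  Orthonormality is transported along the coherence isomorphism from \<open>\<complex> \<oplus> \<dots> \<oplus> \<complex>\<close>.  The vectors
  span because \<open>\<complex> \<otimes> \<complex>\<close> is the line through \<open>1 \<otimes> 1\<close>, the coefficient of a tensor being its value
  at \<open>(1, 1)\<close>.
\<close>

lemma witness_std_onb: "ordered_onb ((W\<^sub>L n ;; W\<^sub>R n) $$ (0, 0)) (map witness_std [0..<n])"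
proof -
  let ?K = "(W\<^sub>L n ;; W\<^sub>R n) $$ (0, 0)"
  interpret K: fd_hilbert ?K by (rule witness_fd_hilbert)
  have inner: "hinner ?K (witness_std i) (witness_std j) = (if i = j then 1 else 0)"
    if "i < n" "j < n" for i j
  proof -
    have "hinner ?K (witness_std i) (witness_std j)
        = hinner (dsum n (\<lambda>_. hilb_C)) (dsum_incl i 1) (dsum_incl j 1)"
      using witness_coherence(3)[OF witness_std_mem witness_std_mem] that
      by (simp add: witness_coherence_std)
    also have "\<dots> = (\<Sum>k<n. if k = i then if i = j then 1 else 0 else 0)"
      unfolding dsum_def hilb_C_def dsum_incl_def hilb.simps by (intro sum.cong) auto
    also have "\<dots> = (if i = j then 1 else 0)" using that by simp
    finally show ?thesis .
  qed
  have "f \<in> K.span (witness_std ` {..<n})" if f: "f \<in> hcarrier ?K" for f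
  proof -
    have "f = (\<Sum>j<n. hscale ?K (f j 1 1) (witness_std j))"
    proof
      fix i
      have "(\<Sum>j<n. hscale ?K (f j 1 1) (witness_std j)) i
          = (\<Sum>j<n. if j = i then fscale (f i 1 1) (pure_tensor hilb_C hilb_C 1 1) else 0)"
        unfolding sum_fun_apply[where x = i]
        by (intro sum.cong)
          (auto simp: witness_entry dsum_def tensor_def witness_std_def dsum_incl_def
            fscale_def fun_eq_iff)
      also have "\<dots> = f i"
      proof (cases "i < n")
        case True
        then have "f i \<in> hcarrier (tensor hilb_C hilb_C)"
          using f by (simp add: witness_entry dsum_def)
        then show ?thesis using True tensor_CC_carrier by simp
      qed (use f in \<open>simp add: witness_entry dsum_def\<close>)
      finally show "f i = (\<Sum>j<n. hscale ?K (f j 1 1) (witness_std j)) i" ..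
    qed
    also have "\<dots> \<in> K.span (witness_std ` {..<n})"
      by (intro K.span_sum K.span_scale K.span_base) auto
    finally show ?thesis .
  qed
  moreover have "K.span (witness_std ` {..<n}) \<subseteq> hcarrier ?K"
    using witness_std_mem by (intro K.span_minimal K.subspace_carrier) auto
  ultimately show ?thesis
    unfolding ordered_onb_def using inner witness_std_mem
    by (auto simp: atLeast0LessThan)
qed


section \<open>Measurements as unitary maps\<close>

lemma unitary_cell_system_iff:
  fixes H :: "'a::ab_group_add hilb" and G :: "'b::ab_group_add hilb mat"
  assumes "fd_hilbert H" "G \<in> one_cells 1 1"
  shows "unitary_cell (system H) G \<mu> \<longleftrightarrow>
    \<mu> \<in> carrier_mat 1 1 \<and> \<mu> $$ (0, 0) \<in> unitary_maps H (G $$ (0, 0))"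
proof -
  have G: "G \<in> carrier_mat 1 1" "fd_hilbert (G $$ (0, 0))"
    using assms(2) by (auto simp: one_cells_def)
  have two: "\<mu> \<in> two_cells (system H) G \<longleftrightarrow>
      \<mu> \<in> carrier_mat 1 1 \<and> \<mu> $$ (0, 0) \<in> hlinear H (G $$ (0, 0))"
    using G(1) by (auto simp: two_cells_def system_def)
  have "vcomp (system H) (dagger (system H) G \<mu>) \<mu> = id_cell (system H) \<and>
      vcomp G \<mu> (dagger (system H) G \<mu>) = id_cell G \<longleftrightarrow> \<mu> $$ (0, 0) \<in> unitary_maps H (G $$ (0, 0))"
    if "\<mu> $$ (0, 0) \<in> hlinear H (G $$ (0, 0))"
    using inverse_to_adjoint_iff[OF assms(1) G(2) that] G(1)
    by (auto simp: vcomp_def dagger_def id_cell_def system_def mat_eq_iff)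
  moreover have "unitary_maps H (G $$ (0, 0)) \<subseteq> hlinear H (G $$ (0, 0))"
    by (auto simp: unitary_maps_def)
  ultimately show ?thesis unfolding unitary_cell_def two by blast
qed

lemma measurement_basis_eq:
  "measurement_basis n H \<mu> =
    map (inv_into (hcarrier H) (\<mu> $$ (0, 0))) (map witness_std [0..<n])"
  by (auto simp: measurement_basis_def inverse_cell_def system_def witness_std_mem)

theorem theorem3p4:
  fixes H :: "'a::ab_group_add hilb" and n :: nat
  assumes "fd_hilbert H"
  shows "bij_betw (measurement_basis n H)
    {\<mu>. nondegenerate_measurement n (system H) \<mu>}
    {as. length as = n \<and> ordered_onb H as}"
proof -
  let ?K = "(W\<^sub>L n ;; W\<^sub>R n) $$ (0, 0)"
  have meas: "nondegenerate_measurement n (system H) \<mu> \<longleftrightarrow>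
      \<mu> \<in> carrier_mat 1 1 \<and> \<mu> $$ (0, 0) \<in> unitary_maps H ?K" for \<mu>
    unfolding nondegenerate_measurement_def
    by (rule unitary_cell_system_iff[OF assms one_comp_one_cell[OF witness_one_cells]])
  have entry: "bij_betw (\<lambda>\<mu>. \<mu> $$ (0, 0))
      {\<mu>. nondegenerate_measurement n (system H) \<mu>} (unitary_maps H ?K)"
    by (rule bij_betw_byWitness[where f' = "\<lambda>u. mat 1 1 (\<lambda>_. u)"])
       (auto simp: meas mat_eq_iff)
  have "measurement_basis n H
      = (\<lambda>u. map (inv_into (hcarrier H) u) (map witness_std [0..<n])) \<circ> (\<lambda>\<mu>. \<mu> $$ (0, 0))"
    by (simp add: fun_eq_iff measurement_basis_eq)
  then show ?thesis
    using bij_betw_trans[OF entry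
        unitaries_bij_onbs[OF assms witness_fd_hilbert witness_std_onb, of n]] by simp
qed

end
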